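(* Let $k\geq 2$ be an integer and let $\beta$ be a positive real number with $\beta<k$. Then there exist a sequence $A=\{a_1\leq a_2\leq a_3\leq\cdots\}$ of positive integers and a constant $C$ such that, for all sufficiently large $n$, $$ \sum_{m\leq n}r_{kA}(m)-Cn^\beta=\begin{cases} O\big(n^{\beta-\beta(k+\beta)/k^2}\sqrt{\log n}\big),&\text{if }k>2\beta,\\ O\big(n^{\beta-3\beta/(2k)}\sqrt{\log n}\big),&\text{if }k<2\beta,\\ O\big(n^{\beta-3/4}\log n\big),&\text{if }k=2\beta, \end{cases} $$ where the implied constants depend only on $k$ and $\beta$.
   Context: For a sequence $A=\{a_1\leq a_2\leq\cdots\}$ of integers with $a_i\to\infty$ and a positive integer $m$, $r_{kA}(m)$ denotes the number of $k$-tuples of indices $(i_1,\ldots,i_k)$ such that $a_{i_1}+a_{i_2}+\cdots+a_{i_k}=m$ (ordered representations of $m$ as a sum of $k$ terms of the sequence, counted by index). *)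

theory Defs
  imports Complex_Main "HOL-Library.Landau_Symbols"
begin

text \<open>A \<open>k\<close>-tuple of indices is a list of length \<open>k\<close>; the sequence is indexed from \<open>0\<close>, which does not
  affect the count. Representations are counted by index, so a value repeated in the sequence
  is counted with multiplicity.\<close>

definition rep_count :: "nat \<Rightarrow> (nat \<Rightarrow> int) \<Rightarrow> int \<Rightarrow> nat" where
  "rep_count k A m = card {is :: nat list. length is = k \<and> (\<Sum>i\<leftarrow>is. A i) = m}"

text \<open>For the sequences considered here the cardinality is that of a finite set.\<close>

lemma finite_representations:
  fixes A :: "nat \<Rightarrow> int"
  assumes "incseq A" "filterlim A at_top sequentially"
  shows "finite {is :: nat list. length is = k \<and> (\<Sum>i\<leftarrow>is. A i) = m}"
proof -
  define c where "c = \<bar>A 0\<bar>"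
  define I where "I = {i. A i \<le> m + int k * c}"
  have "eventually (\<lambda>i. m + int k * c + 1 \<le> A i) sequentially"
    using assms(2) unfolding filterlim_at_top by blast
  then obtain N where N: "m + int k * c + 1 \<le> A i" if "i \<ge> N" for i
    unfolding eventually_sequentially by blast
  have "I \<subseteq> {..<N}"
  proof
    fix i assume "i \<in> I"
    then have "\<not> N \<le> i"
      using N[of i] by (auto simp: I_def)
    then show "i \<in> {..<N}"
      by simp
  qed
  then have fin: "finite I"
    by (rule finite_subset) simp
  have lower: "- c \<le> A i" for i
    using incseqD[OF assms(1), of 0 i] unfolding c_def by linarith
  have sum_lower: "- (int (length js) * c) \<le> (\<Sum>i\<leftarrow>js. A i)" for js :: "nat list"
  proof (induction js)
    case (Cons j js)
    then show ?case
      using lower[of j] by (simp add: distrib_right)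
  qed simp
  have "set js \<subseteq> I" if js: "length js = k" "(\<Sum>i\<leftarrow>js. A i) = m" for js
  proof
    fix i assume "i \<in> set js"
    then obtain us vs where split: "js = us @ i # vs"
      by (meson split_list)
    have "A i = m - (\<Sum>i\<leftarrow>us @ vs. A i)"
      unfolding js(2)[symmetric] split by simp
    also have "\<dots> \<le> m + int (length (us @ vs)) * c"
      using sum_lower[of "us @ vs"] by linarith
    also have "\<dots> \<le> m + int k * c"
    proof -
      have "length (us @ vs) \<le> k"
        unfolding js(1)[symmetric] split by simp
      then have "int (length (us @ vs)) * c \<le> int k * c"
        by (intro mult_right_mono) (simp_all only: c_def of_nat_le_iff abs_ge_zero)
      then show ?thesis
        by linarith
    qed
    finally show "i \<in> I"
      by (simp add: I_def)
  qed
  then have "{is. length is = k \<and> (\<Sum>i\<leftarrow>is. A i) = m} \<subseteq> {is. set is \<subseteq> I \<and> length is = k}"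
    by blast
  then show ?thesis
    by (rule finite_subset) (rule finite_lists_length_eq[OF fin])
qed

end

theory Submission
  imports Defs "HOL-Analysis.Gamma_Function" "HOL-Real_Asymp.Real_Asymp"
    "HOL-Computational_Algebra.Formal_Power_Series"
begin

text \<open>
Put \<open>\<alpha> = \<beta> / k\<close>. A perturbation of $(1-X)^{-\alpha}$ provides weights \<open>h\<close> of size \<open>m powr (\<alpha> - 1)\<close> whose
  \<open>k\<close>-fold convolution has summatory function \<open>C * n powr \<beta>\<close> up to an error far below the required one.
  The summatory function \<open>W\<close> of \<open>h\<close> cuts the weights into slices of mass 1, and the sequence takes one
  element from each slice. Let $G = 1/(1-X)$, let $A$ and $H$ be the generating functions of the sequence and
  of \<open>h\<close>, and $D = A - H$. Then $A^k - H^k$ is a sum of products of $DH$ or $DA = DD + DH$ with powers of $A$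
  and $H$, whose summatory functions are powers of \<open>n powr \<alpha>\<close> at most, so it suffices to bound the coefficients
  of $DHG$ and $DDG$. If the elements are independent and each is distributed like \<open>h\<close> on its slice, these
  coefficients are sums of martingale differences (up to a bounded diagonal part), and Azuma's inequality
  applies. It is made constructive by choosing the elements one after the other.
  The trichotomy is that of the sum of \<open>t powr (2 * \<alpha> - 2)\<close> in the variance of $DHG$: a slice at a distance
  of \<open>t\<close> slices from \<open>n\<close> contributes a difference of size \<open>n powr (\<alpha> * (1 - \<alpha>)) * t powr (\<alpha> - 1)\<close>.
\<close>

text \<open>The plain coefficients of \<open>inv_pow \<alpha>\<close> would not do as weights: the
  summatory function of their \<open>k\<close>-fold convolution has a secondary term of order
  \<open>n powr (\<beta> - 1)\<close>, which for \<open>\<alpha> > 2 / 3\<close> exceeds the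
  permitted error. After the correction the error is
  \<open>O(n powr (\<beta> - \<alpha> - 1))\<close>, which is small enough for every
  \<open>\<alpha> < 1\<close>. In a product of \<open>D\<close> with \<open>k - 1\<close> further
  factors, one of these is paired with \<open>D\<close> and the other \<open>k - 2\<close>
  contribute \<open>n powr (\<beta> - 2 * \<alpha>)\<close>. Hence the final exponent is
  \<open>\<beta> - 2 * \<alpha> + e\<close>, where \<open>n powr e\<close> is the size of the
  standard deviation: \<open>e = \<alpha> * (1 - \<alpha>)\<close> for
  \<open>\<alpha> < 1 / 2\<close> and \<open>e = \<alpha> / 2\<close> for
  \<open>\<alpha> > 1 / 2\<close>. At \<open>1 / 2\<close> the two agree, but the sum in the
  variance is harmonic, whence a full logarithm instead of its root. One sequence has to satisfy two
  inequalities for each \<open>n\<close>. The tail in Azuma's inequality is strong enough to give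
  \<open>n\<close> a weight of order \<open>n powr (-2)\<close>, at the price of the root of a
  logarithm.\<close>

unbundle no vec_syntax
unbundle fps_syntax

section \<open>Powers of $1 - X$\<close>

text \<open>\<open>inv_pow a\<close> is the expansion of $(1-X)^{-a}$.\<close>

definition inv_pow :: "real \<Rightarrow> real fps" where
  "inv_pow a = Abs_fps (\<lambda>n. pochhammer a n / fact n)"

lemma inv_pow_nth: "inv_pow a $ n = pochhammer a n / fact n"
  by (simp add: inv_pow_def)

text \<open>Up to the signs \<open>(-1) ^ n\<close> these are the coefficients of the binomial
  series of exponent \<open>-a\<close>, so the law of exponents is Vandermonde's
  convolution.\<close>

lemma inv_pow_add: "inv_pow (a + b) = inv_pow a * inv_pow b"
proof (rule fps_ext)
  fix n
  have coeff: "inv_pow c $ m = (-1) ^ m * (fps_binomial (-c) $ m)" for c m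
    by (simp add: inv_pow_nth gbinomial_pochhammer)
  have "inv_pow (a + b) $ n = (-1) ^ n * (fps_binomial (- a + - b) $ n)"
    unfolding coeff by simp
  also have "\<dots> = (\<Sum>i=0..n. (-1) ^ n * (fps_binomial (- a) $ i * fps_binomial (- b) $ (n - i)))"
    unfolding fps_binomial_add_mult fps_mult_nth sum_distrib_left ..
  also have "\<dots> = (\<Sum>i=0..n. inv_pow a $ i * inv_pow b $ (n - i))"
  proof (rule sum.cong)
    fix i assume "i \<in> {0..n}"
    then have "(-1 :: real) ^ n = (-1) ^ i * (-1) ^ (n - i)"
      by (simp flip: power_add)
    then show "(-1) ^ n * (fps_binomial (- a) $ i * fps_binomial (- b) $ (n - i))
        = inv_pow a $ i * inv_pow b $ (n - i)"
      unfolding coeff by simp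
  qed simp
  finally show "inv_pow (a + b) $ n = (inv_pow a * inv_pow b) $ n"
    by (simp add: fps_mult_nth)
qed

lemma inv_pow_0: "inv_pow 0 = 1"
  by (rule fps_ext) (simp add: inv_pow_nth pochhammer_0_left)

lemma inv_pow_1_nth: "inv_pow 1 $ n = 1"
  by (simp add: inv_pow_nth pochhammer_fact[symmetric])

lemma inv_pow_mult_1_nth: "(F * inv_pow 1) $ n = (\<Sum>i\<le>n. F $ i)"
  by (simp add: fps_mult_nth inv_pow_1_nth atLeast0AtMost)

lemma inv_pow_minus_1_nth: "inv_pow (-1) $ n = (if n = 0 then 1 else if n = 1 then -1 else 0)"
proof -
  have "pochhammer (-1) n = (0::real)" if "n > 1"
    using that pochhammer_of_nat_eq_0_iff[of 1 n, where ?'a = real] by simp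
  then show ?thesis
    by (auto simp: inv_pow_nth)
qed

lemma inv_pow_Suc_nth: "(real n + 1) * inv_pow a $ Suc n = (a + real n) * inv_pow a $ n"
proof -
  have "fact (Suc n) = (real n + 1) * fact n" "real n + 1 \<noteq> 0"
    by (simp_all add: add.commute)
  then show ?thesis
    by (simp only: inv_pow_nth pochhammer_Suc) simp
qed

text \<open>Passing from \<open>a + 1\<close> to \<open>a\<close> is multiplication by $1-X$; on
  coefficients it acts as the rational factor \<open>a / (a + n)\<close>.\<close>

lemma inv_pow_shift_nth: "(a + real n) * inv_pow a $ n = a * inv_pow (a + 1) $ n"
proof -
  have "(a + real n) * pochhammer a n = a * pochhammer (a + 1) n"
    using pochhammer_rec[of a n] pochhammer_rec'[of a n] by simp
  then show ?thesis
    by (simp add: inv_pow_nth)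
qed

text \<open>Euler's limit for the reciprocal Gamma function, freed of the factor
  \<open>(a + n) / n\<close>. Stated with \<open>rGamma\<close> it also covers the poles of Gamma,
  where the limit is 0.\<close>

lemma inv_pow_nth_limit: "(\<lambda>n. inv_pow a $ n / real n powr (a - 1)) \<longlonglongrightarrow> rGamma a"
proof -
  have "(\<lambda>n. rGamma_series a n * (real n / (a + real n))) \<longlonglongrightarrow> rGamma a * 1"
    by (intro tendsto_mult rGamma_series_LIMSEQ) real_asymp
  moreover have "eventually (\<lambda>n. rGamma_series a n * (real n / (a + real n)) = inv_pow a $ n / real n powr (a - 1)) sequentially"
    using eventually_gt_at_top[of "nat \<lceil>\<bar>a\<bar>\<rceil>"]
  proof eventually_elim
    case (elim n)
    then have "real n > \<bar>a\<bar>"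
      by linarith
    then have n: "real n > 0" "a + real n > 0"
      by linarith+
    have "exp (a * ln (real n)) = real n powr (a - 1) * real n"
      using n by (simp add: powr_def exp_diff left_diff_distrib)
    then have "rGamma_series a n = pochhammer a n * (a + real n) / (fact n * (real n powr (a - 1) * real n))"
      by (simp add: rGamma_series_def pochhammer_Suc)
    moreover have "P * s / (F * (R * m)) * (m / s) = P / F / R" if "s \<noteq> 0" "m \<noteq> 0" for P s F R m :: real
      using that by simp
    ultimately show ?case
      using n by (simp only: inv_pow_nth)
  qed
  ultimately show ?thesis
    by (simp add: filterlim_cong)
qed

lemma inv_pow_nth_bigo: "(\<lambda>n. inv_pow a $ n) \<in> O(\<lambda>n. real n powr (a - 1))"
proof (rule bigoI_tendsto[OF inv_pow_nth_limit])
  show "eventually (\<lambda>n. real n powr (a - 1) \<noteq> 0) sequentially"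
    using eventually_gt_at_top[of 0] by eventually_elim simp
qed

text \<open>Finite linear combinations of powers with exponents at most \<open>e\<close>. Orders add
  under multiplication even when they are negative, which fails for mere O-bounds on coefficients;
  so the algebra is done here and coefficients are estimated only at the end.\<close>

inductive inv_pow_span :: "real \<Rightarrow> real fps \<Rightarrow> bool" for e where
  zero: "inv_pow_span e 0"
| add: "c \<le> e \<Longrightarrow> inv_pow_span e F \<Longrightarrow> inv_pow_span e (fps_const x * inv_pow c + F)"

lemma inv_pow_span_inv_pow: "c \<le> e \<Longrightarrow> inv_pow_span e (fps_const x * inv_pow c)"
  using inv_pow_span.add[OF _ inv_pow_span.zero] by simp

lemma inv_pow_span_add: "inv_pow_span e F \<Longrightarrow> inv_pow_span e G \<Longrightarrow> inv_pow_span e (F + G)"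
  by (induction rule: inv_pow_span.induct) (auto simp: add.assoc intro: inv_pow_span.add)

lemma inv_pow_span_mono: "inv_pow_span e F \<Longrightarrow> e \<le> e' \<Longrightarrow> inv_pow_span e' F"
  by (induction rule: inv_pow_span.induct) (auto intro: inv_pow_span.intros)

lemma inv_pow_span_const_mult: "inv_pow_span e F \<Longrightarrow> inv_pow_span e (fps_const y * F)"
proof (induction rule: inv_pow_span.induct)
  case (add c F x)
  have "fps_const y * (fps_const x * inv_pow c + F) = fps_const (y * x) * inv_pow c + fps_const y * F"
    by (simp add: distrib_left mult.assoc[symmetric])
  then show ?case
    using add by (simp add: inv_pow_span.add)
qed (simp add: inv_pow_span.zero)

lemma inv_pow_span_mult:
  assumes "inv_pow_span e F" "inv_pow_span e' G"
  shows "inv_pow_span (e + e') (F * G)"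
  using assms(1)
proof (induction rule: inv_pow_span.induct)
  case (add c F x)
  have "inv_pow_span (e + e') (inv_pow c * G)"
    using assms(2)
  proof (induction rule: inv_pow_span.induct)
    case (add c' G x')
    have "inv_pow c * (fps_const x' * inv_pow c' + G) = fps_const x' * inv_pow (c + c') + inv_pow c * G"
      by (simp add: inv_pow_add algebra_simps)
    then show ?case
      using add \<open>c \<le> e\<close> by (simp add: inv_pow_span.add)
  qed (simp add: inv_pow_span.zero)
  then have "inv_pow_span (e + e') (fps_const x * (inv_pow c * G) + F * G)"
    using add.IH by (intro inv_pow_span_add inv_pow_span_const_mult)
  then show ?case
    by (simp add: algebra_simps)
qed (simp add: inv_pow_span.zero)

lemma inv_pow_span_bigo:
  "inv_pow_span e F \<Longrightarrow> (\<lambda>n. F $ n) \<in> O(\<lambda>n. real n powr (e - 1))"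
proof (induction rule: inv_pow_span.induct)
  case (add c F x)
  have "(\<lambda>n. real n powr (c - 1)) \<in> O(\<lambda>n. real n powr (e - 1))"
  proof (rule bigoI[of _ 1])
    show "eventually (\<lambda>n. norm (real n powr (c - 1)) \<le> 1 * norm (real n powr (e - 1))) sequentially"
      using eventually_ge_at_top[of 1] by eventually_elim (use add in \<open>auto intro!: powr_mono\<close>)
  qed
  then have "(\<lambda>n. inv_pow c $ n) \<in> O(\<lambda>n. real n powr (e - 1))"
    using inv_pow_nth_bigo landau_o.big_trans by blast
  then have "(\<lambda>n. x * inv_pow c $ n + F $ n) \<in> O(\<lambda>n. real n powr (e - 1))"
    using add by (intro sum_in_bigo) (simp_all add: landau_o.big.cmult_in_iff)
  then show ?case
    by simp
qed simp

text \<open>Binomial expansion to first order. The order of \<open>R\<close> is one less than that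
  of \<open>inv_pow a\<close>, so every term with at least two factors \<open>R\<close> has order at
  most \<open>k * a - 2\<close>.\<close>

lemma perturbed_power_span:
  assumes "inv_pow_span (a - 1) R"
  shows "inv_pow_span (real k * a - 2)
    ((inv_pow a - R) ^ k - inv_pow (real k * a) + of_nat k * (inv_pow (real k * a - a) * R))"
proof (induction k)
  case 0
  then show ?case
    by (simp add: inv_pow_0 inv_pow_span.zero)
next
  case (Suc k)
  define T where "T = (inv_pow a - R) ^ k - inv_pow (real k * a) + of_nat k * (inv_pow (real k * a - a) * R)"
  have P: "inv_pow_span a (inv_pow a)"
    using inv_pow_span_inv_pow[of a a 1] by simp
  have "inv_pow_span a R"
    using assms by (rule inv_pow_span_mono) simp
  then have PR: "inv_pow_span a (inv_pow a - R)"
    using inv_pow_span_add[OF P inv_pow_span_const_mult[of a R "-1"]] by (simp flip: fps_const_neg)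
  have "inv_pow_span (a + (real k * a - 2)) ((inv_pow a - R) * T)"
    using Suc by (intro inv_pow_span_mult PR) (simp add: T_def)
  moreover have "inv_pow_span (((real k * a - a) + (a - 1)) + (a - 1)) (inv_pow (real k * a - a) * R * R)"
    using inv_pow_span_inv_pow[of "real k * a - a" "real k * a - a" 1] assms
    by (intro inv_pow_span_mult) auto
  ultimately have "inv_pow_span (real (Suc k) * a - 2)
      ((inv_pow a - R) * T + fps_const (real k) * (inv_pow (real k * a - a) * R * R))"
    by (intro inv_pow_span_add inv_pow_span_const_mult) (simp_all add: algebra_simps)
  moreover have "(inv_pow a - R) * T + fps_const (real k) * (inv_pow (real k * a - a) * R * R) =
      (inv_pow a - R) ^ Suc k - inv_pow (real (Suc k) * a) + of_nat (Suc k) * (inv_pow (real (Suc k) * a - a) * R)"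
  proof -
    have 1: "inv_pow (real (Suc k) * a) = inv_pow (real k * a) * inv_pow a"
      by (simp add: algebra_simps flip: inv_pow_add)
    have 2: "inv_pow (real k * a) = inv_pow (real k * a - a) * inv_pow a"
      by (simp flip: inv_pow_add)
    have 3: "inv_pow (real (Suc k) * a - a) = inv_pow (real k * a)"
      by (simp add: algebra_simps)
    show ?thesis
      unfolding 3 1 T_def unfolding 2 by (simp add: algebra_simps fps_of_nat)
  qed
  ultimately show ?case
    by simp
qed

section \<open>Coefficient asymptotics with a relative error of order
  \<open>n powr (-2)\<close>\<close>

lemma ln_one_plus_expansion:
  "(\<lambda>n. ln (1 + a / real n) - a / real n + a\<^sup>2 / (2 * (real n)\<^sup>2)) \<in> O(\<lambda>n. 1 / real n ^ 3)"
proof (cases "a = 0")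
  case False
  have "(\<lambda>x::real. ln (1 + x) - x + x\<^sup>2 / 2) \<in> O[at 0](\<lambda>x. x ^ 3)"
    by real_asymp
  moreover have "filterlim (\<lambda>n. a / real n) (at 0) sequentially"
  proof (rule filterlim_atI)
    show "(\<lambda>n. a / real n) \<longlonglongrightarrow> 0"
      by real_asymp
    show "eventually (\<lambda>n. a / real n \<noteq> 0) sequentially"
      using eventually_gt_at_top[of 0] by eventually_elim (use False in simp)
  qed
  ultimately have "(\<lambda>n. ln (1 + a / real n) - a / real n + (a / real n)\<^sup>2 / 2) \<in> O(\<lambda>n. (a / real n) ^ 3)"
    by (rule landau_o.big.compose)
  moreover have "(a / real n)\<^sup>2 / 2 = a\<^sup>2 / (2 * (real n)\<^sup>2)" "(a / real n) ^ 3 = a ^ 3 * (1 / real n ^ 3)" for n :: nat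
    by (simp_all add: power_divide)
  ultimately have "(\<lambda>n. ln (1 + a / real n) - a / real n + a\<^sup>2 / (2 * (real n)\<^sup>2)) \<in> O(\<lambda>n. a ^ 3 * (1 / real n ^ 3))"
    by (simp only:)
  moreover have "O(\<lambda>n. a ^ 3 * (1 / real n ^ 3)) = O(\<lambda>n. 1 / real n ^ 3)"
    using False by (intro landau_o.big.cmult) simp
  ultimately show ?thesis
    by (simp only:)
qed simp

text \<open>As \<open>1 / t ^ 3\<close> is at most the decrease of \<open>2 / t ^ 2\<close> from
  \<open>t\<close> to \<open>t + 1\<close>, subtracting or adding \<open>2 * K / n ^ 2\<close> makes
  \<open>x\<close> eventually increasing or decreasing. The two nested sequences yield the limit and
  the rate at once.\<close>

lemma cubic_increments_limit:
  fixes x :: "nat \<Rightarrow> real"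
  assumes "(\<lambda>n. x (Suc n) - x n) \<in> O(\<lambda>n. 1 / real n ^ 3)"
  shows "\<exists>L. (\<lambda>n. x n - L) \<in> O(\<lambda>n. 1 / (real n)\<^sup>2)"
proof -
  obtain K where K: "K > 0" "eventually (\<lambda>n. norm (x (Suc n) - x n) \<le> K * norm (1 / real n ^ 3)) sequentially"
    using landau_o.bigE[OF assms] by blast
  then obtain N0 where N0: "\<And>n. n \<ge> N0 \<Longrightarrow> norm (x (Suc n) - x n) \<le> K * norm (1 / real n ^ 3)"
    unfolding eventually_sequentially by blast
  define N where "N = max 1 N0"
  define u where "u m = x (N + m) - 2 * K / (real (N + m))\<^sup>2" for m
  define w where "w m = x (N + m) + 2 * K / (real (N + m))\<^sup>2" for m
  have inc: "\<bar>x (Suc n) - x n\<bar> \<le> 2 * K / (real n)\<^sup>2 - 2 * K / (real (Suc n))\<^sup>2" if "n \<ge> N" for n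
  proof -
    define t where "t = real n"
    have t: "t \<ge> 1"
      using that by (simp add: t_def N_def)
    have "1 / t ^ 3 \<le> 2 / t\<^sup>2 - 2 / (t + 1)\<^sup>2"
    proof -
      have "2 / t\<^sup>2 - 2 / (t + 1)\<^sup>2 - 1 / t ^ 3 = (3 * t\<^sup>2 - 1) / (t ^ 3 * (t + 1)\<^sup>2)"
        using t by (simp add: divide_simps) (simp add: algebra_simps power2_eq_square power3_eq_cube)
      also have "\<dots> \<ge> 0"
      proof (intro divide_nonneg_nonneg)
        show "3 * t\<^sup>2 - 1 \<ge> 0"
          using one_le_power[OF t, of 2] by linarith
      qed (use t in auto)
      finally show ?thesis
        by simp
    qed
    then have "K * (1 / t ^ 3) \<le> K * (2 / t\<^sup>2 - 2 / (t + 1)\<^sup>2)"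
      using K by (intro mult_left_mono) auto
    then show ?thesis
      using N0[of n] that by (simp add: t_def N_def algebra_simps)
  qed
  have "incseq u"
  proof (rule incseq_SucI)
    show "u m \<le> u (Suc m)" for m
      using inc[of "N + m"] by (simp add: u_def abs_le_iff)
  qed
  moreover have "decseq w"
  proof (rule decseq_SucI)
    show "w (Suc m) \<le> w m" for m
      using inc[of "N + m"] by (simp add: w_def abs_le_iff)
  qed
  moreover have "u m \<le> w m" for m
    using K by (simp add: u_def w_def)
  moreover have "(\<lambda>m. u m - w m) \<longlonglongrightarrow> 0"
  proof -
    have "(\<lambda>m. - (4 * K / (real N + real m)\<^sup>2)) \<longlonglongrightarrow> 0"
      using K by real_asymp
    then show ?thesis
      by (simp add: u_def w_def)
  qed
  ultimately obtain L where L: "\<And>m. u m \<le> L" "\<And>m. L \<le> w m"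
    using nested_sequence_unique[of u w] by (auto simp: incseq_Suc_iff decseq_Suc_iff)
  have "(\<lambda>n. x n - L) \<in> O(\<lambda>n. 1 / (real n)\<^sup>2)"
  proof (rule bigoI[of _ "2 * K"])
    show "eventually (\<lambda>n. norm (x n - L) \<le> 2 * K * norm (1 / (real n)\<^sup>2)) sequentially"
      using eventually_ge_at_top[of N]
    proof eventually_elim
      case (elim n)
      then show ?case
        using L(1)[of "n - N"] L(2)[of "n - N"] by (simp add: u_def w_def abs_le_iff)
    qed
  qed
  then show ?thesis
    by blast
qed

lemma bigo_exp_minus_1:
  fixes e :: "nat \<Rightarrow> real"
  assumes "e \<longlonglongrightarrow> 0"
  shows "(\<lambda>n. exp (e n) - 1) \<in> O(e)"
proof (rule bigoI[of _ 2])
  have "eventually (\<lambda>n. norm (e n) < 1) sequentially"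
    using order_tendstoD(2)[OF tendsto_norm_zero[OF assms], of 1] by simp
  then show "eventually (\<lambda>n. norm (exp (e n) - 1) \<le> 2 * norm (e n)) sequentially"
  proof eventually_elim
    case (elim n)
    show ?case
    proof (cases "e n \<ge> 0")
      case True
      then have "exp (e n) \<le> 1 + e n + (e n)\<^sup>2"
        using elim by (intro exp_bound) auto
      also have "(e n)\<^sup>2 \<le> e n"
        using elim True by (simp add: power2_eq_square mult_left_le)
      finally show ?thesis
        using True by simp
    next
      case False
      then show ?thesis
        using exp_ge_add_one_self[of "e n"] exp_le_one_iff[of "e n"] unfolding real_norm_def by linarith
    qed
  qed
qed

text \<open>The coefficient \<open>(\<beta> + 1) / 2\<close> is the one for which the term of order \<open>n powr (\<beta> - 1)\<close> cancels.\<close>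

lemma corrected_inv_pow_asymptotics:
  assumes "\<beta> > 0"
  shows "\<exists>C>0. (\<lambda>n. inv_pow (\<beta> + 1) $ n - (\<beta> + 1) / 2 * inv_pow \<beta> $ n - C * real n powr \<beta>)
    \<in> O(\<lambda>n. real n powr (\<beta> - 2))"
proof -
  define g where "g = \<beta> * (\<beta> + 1) / 2"
  define s where "s n = inv_pow (\<beta> + 1) $ n - (\<beta> + 1) / 2 * inv_pow \<beta> $ n" for n
  define x where "x n = ln (s n) - \<beta> * ln (real n)" for n
  define \<Lambda> where "\<Lambda> a n = ln (1 + a / real n)" for a and n :: nat
  define \<rho> where "\<rho> a n = \<Lambda> a n - a / real n + a\<^sup>2 / (2 * (real n)\<^sup>2)" for a and n :: nat
  have g: "g > 0"
    using assms by (simp add: g_def)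
  have pos: "inv_pow (\<beta> + 1) $ n > 0" for n
    using assms by (simp add: inv_pow_nth pochhammer_pos)
  have s_eq: "s n = inv_pow (\<beta> + 1) $ n * ((\<beta> + real n - g) / (\<beta> + real n))" for n
  proof -
    have "inv_pow \<beta> $ n = \<beta> * inv_pow (\<beta> + 1) $ n / (\<beta> + real n)"
      using inv_pow_shift_nth[of \<beta> n] assms by (simp add: field_simps)
    moreover have "\<beta> + real n \<noteq> 0"
      using assms by simp
    ultimately show ?thesis
      unfolding s_def g_def by (simp only:) (simp add: divide_simps, simp add: algebra_simps)
  qed
  have s_pos: "s n > 0" if "real n > g" for n
    using that assms pos[of n] by (simp add: s_eq)
  \<comment> \<open>The ratio \<open>s (Suc n) / s n\<close> is a rational function of
    \<open>n\<close>, so the increments of \<open>x\<close> are sums of logarithms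
    \<open>\<Lambda>\<close>. Their expansions cancel up to second order and only the remainders
    \<open>\<rho>\<close> are left.\<close>
  have step: "x (Suc n) - x n = \<rho> (\<beta> + 1 - g) n + \<rho> \<beta> n - (1 + \<beta>) * \<rho> 1 n - \<rho> (\<beta> - g) n"
    if n: "real n > g" for n
  proof -
    have n0: "real n > 0"
      using n g by linarith
    have "s (Suc n) = s n * (((real n + (\<beta> + 1 - g)) * (real n + \<beta>)) / ((real n + 1) * (real n + (\<beta> - g))))"
    proof -
      have alg: "P * (B + 1) / (m + 1) * ((B + 1 - g) / (B + 1)) =
          P * ((B - g) / B) * (((B + 1 - g) * B) / ((m + 1) * (B - g)))"
        if "B \<noteq> 0" "B + 1 \<noteq> 0" "m + 1 \<noteq> 0" "B - g \<noteq> 0" for P B m :: real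
        using that by (simp add: divide_simps)
      have "inv_pow (\<beta> + 1) $ Suc n = inv_pow (\<beta> + 1) $ n * (\<beta> + real n + 1) / (real n + 1)"
        using inv_pow_Suc_nth[of n "\<beta> + 1"] by (simp add: field_simps)
      moreover have "\<beta> + real (Suc n) = \<beta> + real n + 1"
        by simp
      ultimately have "s (Suc n) = inv_pow (\<beta> + 1) $ n * (\<beta> + real n + 1) / (real n + 1)
          * ((\<beta> + real n + 1 - g) / (\<beta> + real n + 1))"
        by (simp only: s_eq[of "Suc n"])
      also have "\<dots> = s n * (((\<beta> + real n + 1 - g) * (\<beta> + real n)) / ((real n + 1) * (\<beta> + real n - g)))"
        unfolding s_eq[of n] using n n0 assms by (intro alg) auto
      also have "\<beta> + real n + 1 - g = real n + (\<beta> + 1 - g)"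
        by simp
      also have "\<beta> + real n = real n + \<beta>"
        by simp
      also have "real n + \<beta> - g = real n + (\<beta> - g)"
        by simp
      finally show ?thesis .
    qed
    also have "((real n + (\<beta> + 1 - g)) * (real n + \<beta>)) / ((real n + 1) * (real n + (\<beta> - g))) =
        ((1 + (\<beta> + 1 - g) / real n) * (1 + \<beta> / real n)) / ((1 + 1 / real n) * (1 + (\<beta> - g) / real n))"
      using n n0 assms by (simp add: divide_simps)
    finally have "ln (s (Suc n)) = ln (s n) + (\<Lambda> (\<beta> + 1 - g) n + \<Lambda> \<beta> n - (\<Lambda> 1 n + \<Lambda> (\<beta> - g) n))"
    proof -
      have p: "1 + (\<beta> + 1 - g) / real n > 0" "1 + \<beta> / real n > 0" "1 + 1 / real n > 0" "1 + (\<beta> - g) / real n > 0"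
        using n n0 assms by (simp_all add: field_simps add_pos_pos)
      assume "s (Suc n) = s n * (((1 + (\<beta> + 1 - g) / real n) * (1 + \<beta> / real n)) / ((1 + 1 / real n) * (1 + (\<beta> - g) / real n)))"
      then show ?thesis
        using p s_pos[OF n] by (simp add: ln_mult_pos ln_div \<Lambda>_def)
    qed
    moreover have "ln (real (Suc n)) = ln (real n) + \<Lambda> 1 n"
    proof -
      have "real (Suc n) = real n * (1 + 1 / real n)"
        using n0 by (simp add: field_simps)
      moreover have "1 + 1 / real n > 0"
        using n0 by (simp add: add_pos_pos)
      ultimately show ?thesis
        using n0 by (simp only: ln_mult_pos \<Lambda>_def)
    qed
    ultimately have "x (Suc n) - x n = \<Lambda> (\<beta> + 1 - g) n + \<Lambda> \<beta> n - (1 + \<beta>) * \<Lambda> 1 n - \<Lambda> (\<beta> - g) n"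
      by (simp add: x_def algebra_simps)
    \<comment> \<open>This says \<open>\<beta> ^ 2 + \<beta> - 2 * g = 0\<close>, which is where the
      value \<open>(\<beta> + 1) / 2\<close> of the coefficient comes from; the first-order terms
      cancel for every \<open>g\<close>.\<close>
    moreover have "(\<beta> + 1 - g)\<^sup>2 + \<beta>\<^sup>2 - (1 + \<beta>) - (\<beta> - g)\<^sup>2 = 0"
      by (simp add: g_def power2_eq_square algebra_simps)
    then have "((\<beta> + 1 - g)\<^sup>2 + \<beta>\<^sup>2 - (1 + \<beta>) - (\<beta> - g)\<^sup>2) / (2 * (real n)\<^sup>2) = 0"
      by simp
    moreover have "((\<beta> + 1 - g) + \<beta> - (1 + \<beta>) - (\<beta> - g)) / real n = 0"
      by simp
    ultimately show ?thesis
      unfolding \<rho>_def by (simp add: algebra_simps add_divide_distrib diff_divide_distrib)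
  qed
  have \<rho>: "\<rho> a \<in> O(\<lambda>n. 1 / real n ^ 3)" for a
    unfolding \<rho>_def \<Lambda>_def by (rule ln_one_plus_expansion)
  have large: "eventually (\<lambda>n. real n > g) sequentially"
    using filterlim_real_sequentially by (simp add: filterlim_at_top_dense)
  have "(\<lambda>n. \<rho> (\<beta> + 1 - g) n + \<rho> \<beta> n - (1 + \<beta>) * \<rho> 1 n - \<rho> (\<beta> - g) n) \<in> O(\<lambda>n. 1 / real n ^ 3)"
    using \<rho> by (intro sum_in_bigo) (simp_all add: landau_o.big.cmult_in_iff)
  moreover have ev: "eventually (\<lambda>n. x (Suc n) - x n = \<rho> (\<beta> + 1 - g) n + \<rho> \<beta> n - (1 + \<beta>) * \<rho> 1 n - \<rho> (\<beta> - g) n) sequentially"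
    using large by eventually_elim (rule step)
  ultimately have "(\<lambda>n. x (Suc n) - x n) \<in> O(\<lambda>n. 1 / real n ^ 3)"
    by (subst landau_o.big.in_cong[OF ev])
  then obtain L where L: "(\<lambda>n. x n - L) \<in> O(\<lambda>n. 1 / (real n)\<^sup>2)"
    using cubic_increments_limit by blast
  have "(\<lambda>n::nat. 1 / (real n)\<^sup>2) \<in> o(\<lambda>n. 1)"
    by real_asymp
  then have "(\<lambda>n. x n - L) \<in> o(\<lambda>n. 1)"
    by (rule landau_o.big_small_trans[OF L])
  then have "(\<lambda>n. x n - L) \<longlonglongrightarrow> 0"
    using smalloD_tendsto by force
  then have "(\<lambda>n. exp (x n - L) - 1) \<in> O(\<lambda>n. 1 / (real n)\<^sup>2)"
    using bigo_exp_minus_1 L landau_o.big_trans by blast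
  then have "(\<lambda>n. exp L * real n powr \<beta> * (exp (x n - L) - 1)) \<in> O(\<lambda>n. real n powr \<beta> * (1 / (real n)\<^sup>2))"
    by (intro landau_o.big.mult) simp_all
  also have "(\<lambda>n. real n powr \<beta> * (1 / (real n)\<^sup>2)) \<in> O(\<lambda>n. real n powr (\<beta> - 2))"
    by (rule bigoI[of _ 1], rule eventually_mono[OF eventually_gt_at_top[of 0]])
      (simp add: powr_diff powr_numeral)
  finally have "(\<lambda>n. exp L * real n powr \<beta> * (exp (x n - L) - 1)) \<in> O(\<lambda>n. real n powr (\<beta> - 2))" .
  moreover have ev: "eventually (\<lambda>n. exp L * real n powr \<beta> * (exp (x n - L) - 1) = s n - exp L * real n powr \<beta>) sequentially"
    using large
  proof eventually_elim
    case (elim n)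
    then have n: "real n > 0"
      using g by linarith
    then have "exp (x n - L) * (exp L * real n powr \<beta>) = s n"
      using s_pos[OF elim] by (simp add: x_def exp_diff powr_def)
    then show ?case
      by (simp add: algebra_simps)
  qed
  ultimately have "(\<lambda>n. s n - exp L * real n powr \<beta>) \<in> O(\<lambda>n. real n powr (\<beta> - 2))"
    by (subst landau_o.big.in_cong[OF ev, symmetric])
  then show ?thesis
    unfolding s_def by (intro exI[of _ "exp L"]) simp
qed

section \<open>The weights\<close>

text \<open>The perturbation of $(1-X)^{-\alpha}$ by $q (1-X)^{1-\alpha}$ removes the secondary term of the
  summatory function of the \<open>k\<close>-th power; the one by $1 - X$ only makes the constant coefficient vanish.\<close>

definition weight_series :: "real \<Rightarrow> real \<Rightarrow> real fps" where
  "weight_series \<alpha> q = inv_pow \<alpha> - (fps_const q * inv_pow (\<alpha> - 1) + fps_const (1 - q) * inv_pow (-1))"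

lemma weight_series_nth_0: "weight_series \<alpha> q $ 0 = 0"
  by (simp add: weight_series_def inv_pow_nth)

text \<open>The ratio to \<open>m powr (\<alpha> - 1)\<close> is positive and tends to
  \<open>rGamma \<alpha> \<noteq> 0\<close>, so it and its inverse are bounded. Positivity is due to
  the sign of the perturbation: for \<open>m \<ge> 1\<close> the coefficients of
  \<open>inv_pow (\<alpha> - 1)\<close> are negative, and they are subtracted.\<close>

lemma weight_series_bounds:
  assumes "0 < \<alpha>" "\<alpha> < 1" "0 \<le> q" "q \<le> 1"
  shows "\<exists>c C. 0 < c \<and> (\<forall>m\<ge>1. c * real m powr (\<alpha> - 1) \<le> weight_series \<alpha> q $ m \<and>
    weight_series \<alpha> q $ m \<le> C * real m powr (\<alpha> - 1))"
proof -
  define r where "r m = weight_series \<alpha> q $ m / real m powr (\<alpha> - 1)" for m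
  have shift: "inv_pow (\<alpha> - 1) $ m = - ((1 - \<alpha>) / (\<alpha> - 1 + real m)) * inv_pow \<alpha> $ m" if "m \<ge> 1" for m
  proof -
    have "\<alpha> - 1 + real m > 0"
      using that assms by linarith
    then show ?thesis
      using inv_pow_shift_nth[of "\<alpha> - 1" m] by (simp add: field_simps)
  qed
  have w_eq: "weight_series \<alpha> q $ m = inv_pow \<alpha> $ m + q * ((1 - \<alpha>) / (\<alpha> - 1 + real m) * inv_pow \<alpha> $ m)
      + (if m = 1 then 1 - q else 0)" if "m \<ge> 1" for m
    using that shift[OF that] by (simp add: weight_series_def inv_pow_minus_1_nth)
  have inv_pos: "inv_pow \<alpha> $ m > 0" for m
    using assms by (simp add: inv_pow_nth pochhammer_pos)
  have r_pos: "r m > 0" if "m \<ge> 1" for m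
  proof -
    have "q * ((1 - \<alpha>) / (\<alpha> - 1 + real m) * inv_pow \<alpha> $ m) \<ge> 0"
      using that assms inv_pos[of m] by (intro mult_nonneg_nonneg divide_nonneg_nonneg) auto
    moreover have "(if m = 1 then 1 - q else 0) \<ge> 0"
      using assms by simp
    ultimately have "weight_series \<alpha> q $ m > 0"
      using inv_pos[of m] unfolding w_eq[OF that] by linarith
    then show ?thesis
      using that by (simp add: r_def)
  qed
  have "(\<lambda>m. inv_pow \<alpha> $ m / real m powr (\<alpha> - 1) * (1 + q * ((1 - \<alpha>) / (\<alpha> - 1 + real m)))) \<longlonglongrightarrow> rGamma \<alpha> * 1"
    by (intro tendsto_mult inv_pow_nth_limit) real_asymp
  moreover have "eventually (\<lambda>m. inv_pow \<alpha> $ m / real m powr (\<alpha> - 1) * (1 + q * ((1 - \<alpha>) / (\<alpha> - 1 + real m))) = r m) sequentially"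
    using eventually_gt_at_top[of 1]
  proof eventually_elim
    case (elim m)
    then have "weight_series \<alpha> q $ m = inv_pow \<alpha> $ m + q * ((1 - \<alpha>) / (\<alpha> - 1 + real m) * inv_pow \<alpha> $ m)"
      using w_eq[of m] by simp
    then show ?case
      by (simp only: r_def) (simp add: add_divide_distrib distrib_left mult_ac)
  qed
  ultimately have lim: "r \<longlonglongrightarrow> rGamma \<alpha>"
    by (simp add: filterlim_cong)
  have "rGamma \<alpha> \<noteq> 0"
    using assms nonpos_Ints_nonpos[of \<alpha>] by (auto simp: rGamma_eq_zero_iff)
  then have lim': "(\<lambda>m. inverse (r m)) \<longlonglongrightarrow> inverse (rGamma \<alpha>)"
    using lim by (intro tendsto_inverse)
  obtain C where C: "\<And>m. norm (r m) \<le> C"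
    using lim convergent_imp_Bseq[of r] by (auto simp: convergent_def Bseq_def)
  obtain D where D: "D > 0" "\<And>m. norm (inverse (r m)) \<le> D"
    using lim' convergent_imp_Bseq[of "\<lambda>m. inverse (r m)"] by (auto simp: convergent_def Bseq_def)
  have "inverse D * real m powr (\<alpha> - 1) \<le> weight_series \<alpha> q $ m \<and>
      weight_series \<alpha> q $ m \<le> C * real m powr (\<alpha> - 1)" if "m \<ge> 1" for m
  proof -
    have "inverse D \<le> r m"
      using D(2)[of m] D(1) r_pos[OF that] by (simp add: field_simps)
    moreover have "r m \<le> C"
      using C[of m] by simp
    moreover have "weight_series \<alpha> q $ m = r m * real m powr (\<alpha> - 1)"
      using that by (simp add: r_def)
    ultimately show ?thesis
      by (simp add: mult_right_mono)
  qed
  then show ?thesis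
    using D(1) by (intro exI[of _ "inverse D"] exI[of _ C]) auto
qed

text \<open>To first order the perturbation changes the summatory series by
  \<open>- k * q * inv_pow \<beta>\<close>, and \<open>q\<close> is chosen so that
  \<open>k * q = (\<beta> + 1) / 2\<close>, the coefficient in
  \<open>corrected_inv_pow_asymptotics\<close>. The correction by $1-X$ contributes a multiple of
  \<open>inv_pow (\<beta> - \<alpha>)\<close>, which sets the size of the error.\<close>

lemma weight_series_power_asymptotics:
  fixes k :: nat and \<alpha> :: real
  assumes "0 < \<alpha>" "\<alpha> < 1" "k \<ge> 1"
  defines "\<beta> \<equiv> real k * \<alpha>"
  shows "\<exists>C>0. (\<lambda>n. (weight_series \<alpha> ((\<beta> + 1) / (2 * real k)) ^ k * inv_pow 1) $ n - C * real n powr \<beta>)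
    \<in> O(\<lambda>n. real n powr (\<beta> - \<alpha> - 1))"
proof -
  define q where "q = (\<beta> + 1) / (2 * real k)"
  define R where "R = fps_const q * inv_pow (\<alpha> - 1) + fps_const (1 - q) * inv_pow (-1)"
  define T where "T = (inv_pow \<alpha> - R) ^ k - inv_pow \<beta> + of_nat k * (inv_pow (\<beta> - \<alpha>) * R)"
  have \<beta>: "\<beta> > 0"
    using assms by (simp add: \<beta>_def)
  have "inv_pow_span (\<alpha> - 1) R"
    unfolding R_def using assms by (intro inv_pow_span_add inv_pow_span_inv_pow) auto
  then have "inv_pow_span (\<beta> - 2) T"
    unfolding T_def \<beta>_def by (rule perturbed_power_span)
  then have "inv_pow_span (\<beta> - 2 + 1) (T * (fps_const 1 * inv_pow 1))"
    by (intro inv_pow_span_mult inv_pow_span_inv_pow) auto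
  then have T: "(\<lambda>n. (T * inv_pow 1) $ n) \<in> O(\<lambda>n. real n powr (\<beta> - 2))"
    using inv_pow_span_bigo[of "\<beta> - 1" "T * inv_pow 1"] by simp
  obtain C where C: "C > 0" "(\<lambda>n. inv_pow (\<beta> + 1) $ n - (\<beta> + 1) / 2 * inv_pow \<beta> $ n - C * real n powr \<beta>)
      \<in> O(\<lambda>n. real n powr (\<beta> - 2))"
    using corrected_inv_pow_asymptotics[OF \<beta>] by blast
  have "(\<lambda>n. (inv_pow (\<beta> + 1) $ n - (\<beta> + 1) / 2 * inv_pow \<beta> $ n - C * real n powr \<beta>)
      + (T * inv_pow 1) $ n) \<in> O(\<lambda>n. real n powr (\<beta> - 2))"
    by (rule sum_in_bigo(1)[OF C(2) T])
  also have "(\<lambda>n. real n powr (\<beta> - 2)) \<in> O(\<lambda>n. real n powr (\<beta> - \<alpha> - 1))"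
  proof (rule bigoI[of _ 1])
    show "eventually (\<lambda>n. norm (real n powr (\<beta> - 2)) \<le> 1 * norm (real n powr (\<beta> - \<alpha> - 1))) sequentially"
      using eventually_ge_at_top[of 1] by eventually_elim (use assms in \<open>auto intro!: powr_mono\<close>)
  qed
  finally have 1: "(\<lambda>n. (inv_pow (\<beta> + 1) $ n - (\<beta> + 1) / 2 * inv_pow \<beta> $ n - C * real n powr \<beta>)
      + (T * inv_pow 1) $ n) \<in> O(\<lambda>n. real n powr (\<beta> - \<alpha> - 1))" .
  have 2: "(\<lambda>n. real k * (1 - q) * inv_pow (\<beta> - \<alpha>) $ n) \<in> O(\<lambda>n. real n powr (\<beta> - \<alpha> - 1))"
    using inv_pow_nth_bigo[of "\<beta> - \<alpha>"] by (simp add: landau_o.big.cmult_in_iff)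
  have kq: "real k * q = (\<beta> + 1) / 2"
    using assms by (simp add: q_def)
  have "(inv_pow \<alpha> - R) ^ k * inv_pow 1 = T * inv_pow 1 + inv_pow (\<beta> + 1)
      - of_nat k * (fps_const q * inv_pow \<beta> + fps_const (1 - q) * inv_pow (\<beta> - \<alpha>))"
  proof -
    have e1: "inv_pow (\<beta> + 1) = inv_pow \<beta> * inv_pow 1"
      by (rule inv_pow_add)
    have e2: "inv_pow \<beta> = inv_pow (\<beta> - \<alpha>) * inv_pow (\<alpha> - 1) * inv_pow 1"
      by (simp flip: inv_pow_add)
    have e3: "inv_pow (\<beta> - \<alpha>) = inv_pow (\<beta> - \<alpha>) * inv_pow (-1) * inv_pow 1"
      by (simp flip: inv_pow_add)
    have "T * inv_pow 1 = (inv_pow \<alpha> - R) ^ k * inv_pow 1 - inv_pow \<beta> * inv_pow 1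
        + of_nat k * (fps_const q * (inv_pow (\<beta> - \<alpha>) * inv_pow (\<alpha> - 1) * inv_pow 1)
          + fps_const (1 - q) * (inv_pow (\<beta> - \<alpha>) * inv_pow (-1) * inv_pow 1))"
      by (simp add: T_def R_def algebra_simps)
    then show ?thesis
      unfolding e2[symmetric] e3[symmetric] e1[symmetric] by simp
  qed
  then have nth: "((inv_pow \<alpha> - R) ^ k * inv_pow 1) $ n = (T * inv_pow 1) $ n + inv_pow (\<beta> + 1) $ n
      - (real k * q * inv_pow \<beta> $ n + real k * (1 - q) * inv_pow (\<beta> - \<alpha>) $ n)" for n
    by (simp add: fps_of_nat[symmetric] distrib_left mult.assoc del: fps_const_sub)
  have eq: "(weight_series \<alpha> q ^ k * inv_pow 1) $ n - C * real n powr \<beta> =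
      inv_pow (\<beta> + 1) $ n - (\<beta> + 1) / 2 * inv_pow \<beta> $ n - C * real n powr \<beta>
      + (T * inv_pow 1) $ n - real k * (1 - q) * inv_pow (\<beta> - \<alpha>) $ n" for n
  proof -
    have "weight_series \<alpha> q = inv_pow \<alpha> - R"
      by (simp add: weight_series_def R_def)
    then show ?thesis
      by (simp only: nth kq)
  qed
  have "(\<lambda>n. (weight_series \<alpha> q ^ k * inv_pow 1) $ n - C * real n powr \<beta>) \<in> O(\<lambda>n. real n powr (\<beta> - \<alpha> - 1))"
    unfolding eq by (rule sum_in_bigo(2)[OF 1 2])
  then show ?thesis
    using C(1) by (auto simp: q_def)
qed

section \<open>Adaptive choice\<close>

text \<open>The power series are compared term by term, by
  \<open>2 ^ n * fact n \<le> fact (2 * n)\<close>.\<close>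

lemma cosh_le_exp_half_square: "cosh (x::real) \<le> exp (x\<^sup>2 / 2)"
proof -
  have c: "(\<lambda>n. if even n then x ^ n /\<^sub>R fact n else 0) sums cosh x"
    by (rule cosh_converges)
  have "(\<lambda>n. (\<lambda>n. if even n then x ^ n /\<^sub>R fact n else 0) (2 * n)) sums cosh x"
    using c by (subst sums_mono_reindex) (auto simp: strict_mono_def elim!: oddE evenE)
  then have 1: "(\<lambda>n. x ^ (2 * n) / fact (2 * n)) sums cosh x"
    by (simp add: divide_inverse mult.commute)
  have 2: "(\<lambda>n. (x\<^sup>2 / 2) ^ n / fact n) sums exp (x\<^sup>2 / 2)"
    using exp_converges[of "x\<^sup>2 / 2"] by (simp add: field_simps)
  have "2 ^ n * fact n \<le> (fact (2 * n) :: real)" for n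
  proof (induction n)
    case (Suc n)
    have "2 ^ Suc n * fact (Suc n) = (2 * real (Suc n)) * (2 ^ n * fact n :: real)"
      by simp
    also have "\<dots> \<le> (2 * real (Suc n)) * fact (2 * n)"
      using Suc by (intro mult_left_mono) auto
    also have "\<dots> \<le> (2 * real (Suc n)) * (real (2 * n + 1) * fact (2 * n))"
    proof (intro mult_left_mono)
      show "fact (2 * n) \<le> real (2 * n + 1) * fact (2 * n)"
        using mult_right_mono[of 1 "real (2 * n + 1)" "fact (2 * n) :: real"] by simp
    qed auto
    also have "\<dots> = fact (2 * Suc n)"
      by (simp add: algebra_simps)
    finally show ?case .
  qed simp
  then have "x ^ (2 * n) / fact (2 * n) \<le> x ^ (2 * n) / (2 ^ n * fact n)" for n
    by (intro divide_left_mono) (auto simp: zero_le_even_power)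
  then have "x ^ (2 * n) / fact (2 * n) \<le> (x\<^sup>2 / 2) ^ n / fact n" for n
    by (simp add: power_divide power_mult)
  then show ?thesis
    using sums_le[OF _ 1 2] by blast
qed

text \<open>The convex function \<open>exp\<close> lies below its chord over the interval from
  \<open>-c\<close> to \<open>c\<close>; this is applied to both halves of \<open>cosh\<close>. The
  bound is affine in \<open>z\<close>, so its second summand disappears when \<open>z\<close> has
  mean 0.\<close>

lemma cosh_add_convex:
  fixes s z c :: real
  assumes "\<bar>z\<bar> \<le> c" "c > 0"
  shows "cosh (s + z) \<le> cosh s * cosh c + z / c * (sinh s * sinh c)"
proof -
  have exp_le: "exp (t * z) \<le> (1 + z / c) / 2 * exp (t * c) + (1 - z / c) / 2 * exp (- (t * c))" for t :: real
  proof -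
    have "convex_on UNIV (exp :: real \<Rightarrow> real)"
      by (rule exp_convex)
    then have "exp ((1 - (1 + z / c) / 2) *\<^sub>R (- (t * c)) + ((1 + z / c) / 2) *\<^sub>R (t * c))
      \<le> (1 - (1 + z / c) / 2) * exp (- (t * c)) + ((1 + z / c) / 2) * exp (t * c)"
      using assms by (intro convex_onD) (auto simp: field_simps abs_le_iff)
    moreover have "(1 - (1 + z / c) / 2) *\<^sub>R (- (t * c)) + ((1 + z / c) / 2) *\<^sub>R (t * c) = t * z"
      using assms by (simp add: field_simps)
    ultimately show ?thesis
      by (simp add: field_simps)
  qed
  have "cosh (s + z) = (exp s * exp (1 * z) + exp (- s) * exp ((-1) * z)) / 2"
    by (simp add: cosh_def exp_add exp_diff exp_minus divide_simps)
  also have "\<dots> \<le> (exp s * ((1 + z / c) / 2 * exp (1 * c) + (1 - z / c) / 2 * exp (- (1 * c)))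
      + exp (- s) * ((1 + z / c) / 2 * exp ((-1) * c) + (1 - z / c) / 2 * exp (- ((-1) * c)))) / 2"
    by (intro divide_right_mono add_mono mult_left_mono exp_le) auto
  also have "\<dots> = cosh s * cosh c + z / c * (sinh s * sinh c)"
    using assms by (simp add: cosh_def sinh_def field_simps)
  finally show ?thesis .
qed

text \<open>Hoeffding's lemma with \<open>cosh\<close> in place of \<open>exp\<close>: a single
  potential then controls deviations of both signs.\<close>

lemma mean_cosh_le:
  fixes p Z :: "'a \<Rightarrow> real"
  assumes "finite S" "\<And>y. y \<in> S \<Longrightarrow> p y \<ge> 0" "(\<Sum>y\<in>S. p y) = 1" "(\<Sum>y\<in>S. p y * Z y) = 0"
    and "\<And>y. y \<in> S \<Longrightarrow> \<bar>Z y\<bar> \<le> c"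
  shows "(\<Sum>y\<in>S. p y * cosh (s + Z y)) \<le> cosh s * exp (c\<^sup>2 / 2)"
proof (cases "c > 0")
  case True
  have "(\<Sum>y\<in>S. p y * cosh (s + Z y)) \<le> (\<Sum>y\<in>S. p y * (cosh s * cosh c + Z y / c * (sinh s * sinh c)))"
    using assms True by (intro sum_mono mult_left_mono cosh_add_convex) auto
  also have "\<dots> = (\<Sum>y\<in>S. p y) * (cosh s * cosh c) + (\<Sum>y\<in>S. p y * Z y) * (sinh s * sinh c / c)"
    by (simp add: sum_distrib_right sum_distrib_left sum.distrib sum_divide_distrib algebra_simps)
  also have "\<dots> = cosh s * cosh c"
    using assms by simp
  also have "\<dots> \<le> cosh s * exp (c\<^sup>2 / 2)"
    by (intro mult_left_mono cosh_le_exp_half_square) auto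
  finally show ?thesis .
next
  case False
  then have "Z y = 0" if "y \<in> S" for y
    using assms(5)[OF that] by linarith
  then have "(\<Sum>y\<in>S. p y * cosh (s + Z y)) = (\<Sum>y\<in>S. p y) * cosh s"
    by (simp add: sum_distrib_right)
  also have "\<dots> \<le> cosh s * exp (c\<^sup>2 / 2)"
    using assms(3) by simp
  finally show ?thesis .
qed

text \<open>The method of conditional expectations applied to the potential of Azuma's inequality: every
  choice is made so that all partial sums over \<open>n\<close> of the potential stay below 1. As the choice
  sets are finite, no summation over infinitely many \<open>n\<close> is needed.\<close>

lemma adaptive_choice:
  fixes p :: "nat \<Rightarrow> nat \<Rightarrow> real" and S :: "nat \<Rightarrow> nat set"
    and Z :: "nat \<Rightarrow> nat \<Rightarrow> (nat \<Rightarrow> nat) \<Rightarrow> real" and c :: "nat \<Rightarrow> nat \<Rightarrow> real" and v :: "nat \<Rightarrow> real"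
  assumes fin: "\<And>j. finite (S j)" and p0: "\<And>j y. y \<in> S j \<Longrightarrow> p j y \<ge> 0"
    and p1: "\<And>j. (\<Sum>y\<in>S j. p j y) = 1"
    and local: "\<And>n j a b. (\<And>i. i \<le> j \<Longrightarrow> a i = b i) \<Longrightarrow> Z n j a = Z n j b"
    and mean: "\<And>n j a. (\<Sum>y\<in>S j. p j y * Z n j (a(j := y))) = 0"
    and bound: "\<And>n j a. (\<And>i. i \<le> j \<Longrightarrow> a i \<in> S i) \<Longrightarrow> \<bar>Z n j a\<bar> \<le> c n j"
    and var: "\<And>n J. (\<Sum>j<J. (c n j)\<^sup>2) \<le> v n" and v: "\<And>n. v n > 0"
  shows "\<exists>a. (\<forall>i. a i \<in> S i) \<and>
    (\<forall>n J. \<bar>\<Sum>j<J. Z n j a\<bar> \<le> 4 * sqrt (v n * ln (real n + 2)))"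
proof -
  \<comment> \<open>The parameter in Azuma's inequality, with
    \<open>(l n) ^ 2 * v n = ln (n + 2)\<close>. The compensating exponential then costs only a
    power of \<open>n + 2\<close>, and division by \<open>l n\<close> turns a multiple of this
    logarithm into one of \<open>sqrt (v n * ln (n + 2))\<close>.\<close>
  define l where "l n = sqrt (ln (real n + 2) / v n)" for n
  \<comment> \<open>Telescoping weights with partial sums below 1, whose inverses are at most
    \<open>(n + 2) ^ 2\<close>.\<close>
  define w where "w n = 1 / ((real n + 1) * (real n + 2))" for n
  define \<phi> where "\<phi> n J a = w n * (exp (- (l n)\<^sup>2 / 2 * (\<Sum>j<J. (c n j)\<^sup>2)) * cosh (l n * (\<Sum>j<J. Z n j a)))"
    for n J a
  have w_pos: "w n > 0" for n
    by (simp add: w_def)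
  have \<phi>_nonneg: "\<phi> n J a \<ge> 0" for n J a
    using w_pos[of n] by (simp add: \<phi>_def)
  define inv where "inv J a \<longleftrightarrow> (\<forall>i<J. a i \<in> S i) \<and> (\<forall>M. (\<Sum>n<M. \<phi> n J a) \<le> 1)" for J a
  have w_sum: "(\<Sum>n<M. w n) = 1 - 1 / (real M + 1)" for M
  proof (induction M)
    case (Suc M)
    then have "(\<Sum>n<Suc M. w n) = 1 - 1 / (real M + 1) + 1 / ((real M + 1) * (real M + 2))"
      by (simp add: w_def)
    also have "\<dots> = 1 - 1 / (real M + 2)"
      by (simp add: divide_simps) (simp add: algebra_simps)
    finally show ?case
      by (simp add: add.commute)
  qed simp
  have start: "inv 0 a" for a
    using w_sum by (simp add: inv_def \<phi>_def)
  have \<phi>_local: "\<phi> n J a = \<phi> n J b" if "\<And>i. i < J \<Longrightarrow> a i = b i" for n J a b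
  proof -
    have "(\<Sum>j<J. Z n j a) = (\<Sum>j<J. Z n j b)"
      using that by (intro sum.cong local) auto
    then show ?thesis
      by (simp add: \<phi>_def)
  qed
  \<comment> \<open>The supermartingale property: the exponential factor of \<open>\<phi>\<close>
    cancels the growth that \<open>mean_cosh_le\<close> allows.\<close>
  have \<phi>_mean: "(\<Sum>y\<in>S J. p J y * \<phi> n (Suc J) (a(J := y))) \<le> \<phi> n J a" if "\<forall>i<J. a i \<in> S i" for n J a
  proof -
    define e where "e = exp (- (l n)\<^sup>2 / 2 * (\<Sum>j<J. (c n j)\<^sup>2))"
    define s where "s = l n * (\<Sum>j<J. Z n j a)"
    have e: "exp (- (l n)\<^sup>2 / 2 * (\<Sum>j<Suc J. (c n j)\<^sup>2)) = e * exp (- ((l n * c n J)\<^sup>2 / 2))"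
      by (simp add: e_def algebra_simps power_mult_distrib add_divide_distrib flip: exp_add)
    have Zs: "l n * (\<Sum>j<Suc J. Z n j (a(J := y))) = s + l n * Z n J (a(J := y))" for y
    proof -
      have "(\<Sum>j<J. Z n j (a(J := y))) = (\<Sum>j<J. Z n j a)"
        by (intro sum.cong local) auto
      then show ?thesis
        by (simp add: s_def algebra_simps)
    qed
    have "(\<Sum>y\<in>S J. p J y * \<phi> n (Suc J) (a(J := y))) =
        w n * e * exp (- ((l n * c n J)\<^sup>2 / 2)) * (\<Sum>y\<in>S J. p J y * cosh (s + l n * Z n J (a(J := y))))"
      unfolding \<phi>_def e Zs by (simp add: sum_distrib_left mult_ac)
    also have "\<dots> \<le> w n * e * exp (- ((l n * c n J)\<^sup>2 / 2)) * (cosh s * exp ((l n * c n J)\<^sup>2 / 2))"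
    proof (intro mult_left_mono mean_cosh_le fin p0 p1)
      have "(\<Sum>y\<in>S J. p J y * (l n * Z n J (a(J := y)))) = l n * (\<Sum>y\<in>S J. p J y * Z n J (a(J := y)))"
        by (simp add: sum_distrib_left mult_ac)
      then show "(\<Sum>y\<in>S J. p J y * (l n * Z n J (a(J := y)))) = 0"
        using mean by simp
      show "\<bar>l n * Z n J (a(J := y))\<bar> \<le> l n * c n J" if "y \<in> S J" for y
      proof -
        have "l n \<ge> 0"
          using v[of n] by (simp add: l_def)
        then show ?thesis
          using bound[of J "a(J := y)" n] that \<open>\<forall>i<J. a i \<in> S i\<close>
          by (auto simp: abs_mult intro!: mult_left_mono)
      qed
    qed (use w_pos[of n] in \<open>auto simp: e_def\<close>)
    also have "\<dots> = \<phi> n J a"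
      by (simp add: \<phi>_def e_def s_def exp_minus)
    finally show ?thesis .
  qed
  have step: "\<exists>y\<in>S J. inv (Suc J) (a(J := y))" if "inv J a" for J a
  proof (rule ccontr)
    assume neg: "\<not> (\<exists>y\<in>S J. inv (Suc J) (a(J := y)))"
    have aS: "\<forall>i<J. a i \<in> S i" and le1: "(\<Sum>n<M. \<phi> n J a) \<le> 1" for M
      using that by (auto simp: inv_def)
    have "\<exists>M. (\<Sum>n<M. \<phi> n (Suc J) (a(J := y))) > 1" if "y \<in> S J" for y
    proof -
      have "\<forall>i<Suc J. (a(J := y)) i \<in> S i"
        using aS that by (auto simp: less_Suc_eq)
      then show ?thesis
        using neg that unfolding inv_def by (meson not_le)
    qed
    then obtain M where M: "\<And>y. y \<in> S J \<Longrightarrow> (\<Sum>n<M y. \<phi> n (Suc J) (a(J := y))) > 1"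
      by metis
    define N where "N = Max (M ` S J)"
    have gt: "(\<Sum>n<N. \<phi> n (Suc J) (a(J := y))) > 1" if "y \<in> S J" for y
    proof -
      have "M y \<le> N"
        using fin that by (simp add: N_def)
      then have "(\<Sum>n<M y. \<phi> n (Suc J) (a(J := y))) \<le> (\<Sum>n<N. \<phi> n (Suc J) (a(J := y)))"
        by (intro sum_mono2 \<phi>_nonneg) auto
      then show ?thesis
        using M[OF that] by linarith
    qed
    \<comment> \<open>A choice of positive weight makes the averaged inequality strict.\<close>
    obtain y0 where y0: "y0 \<in> S J" "p J y0 > 0"
    proof -
      have "(\<Sum>y\<in>S J. p J y) \<le> 0" if "\<forall>y\<in>S J. p J y \<le> 0"
        using that by (intro sum_nonpos) auto
      then show thesis
        using that p1[of J] by force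
    qed
    have "1 = (\<Sum>y\<in>S J. p J y)"
      using p1 by simp
    also have "\<dots> < (\<Sum>y\<in>S J. p J y * (\<Sum>n<N. \<phi> n (Suc J) (a(J := y))))"
    proof (rule sum_strict_mono_ex1[OF fin])
      show "\<forall>y\<in>S J. p J y \<le> p J y * (\<Sum>n<N. \<phi> n (Suc J) (a(J := y)))"
        using mult_left_mono[OF less_imp_le[OF gt] p0] by force
      show "\<exists>y\<in>S J. p J y < p J y * (\<Sum>n<N. \<phi> n (Suc J) (a(J := y)))"
        using y0 gt by (auto simp: mult_less_cancel_left1 intro!: bexI[of _ y0])
    qed
    also have "\<dots> = (\<Sum>n<N. \<Sum>y\<in>S J. p J y * \<phi> n (Suc J) (a(J := y)))"
      by (subst sum.swap) (simp add: sum_distrib_left)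
    also have "\<dots> \<le> (\<Sum>n<N. \<phi> n J a)"
      by (intro sum_mono \<phi>_mean aS)
    also have "\<dots> \<le> 1"
      by (rule le1)
    finally show False
      by simp
  qed
  have "\<exists>f. \<forall>J. inv J (f J) \<and> (\<exists>y\<in>S J. f (Suc J) = (f J)(J := y))"
    by (rule dependent_nat_choice) (use start step in blast)+
  then obtain f where f: "\<And>J. inv J (f J)" "\<And>J. \<exists>y\<in>S J. f (Suc J) = (f J)(J := y)"
    by blast
  \<comment> \<open>Step \<open>J\<close> changes only the entry at \<open>J\<close>, so the
    functions \<open>f J\<close> stabilise and the sequence is read off from them.\<close>
  define a where "a i = f (Suc i) i" for i
  have stable: "f (i + Suc d) i = a i" for i d
  proof (induction d)
    case (Suc d)
    obtain y where "f (Suc (i + Suc d)) = (f (i + Suc d))(i + Suc d := y)"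
      using f(2) by blast
    then show ?case
      using Suc by simp
  qed (simp add: a_def)
  have agree: "f J i = a i" if "i < J" for i J
    using stable[of i "J - Suc i"] that by simp
  have aS: "a i \<in> S i" for i
    using f(1)[of "Suc i"] by (auto simp: inv_def a_def)
  have "\<bar>\<Sum>j<J. Z n j a\<bar> \<le> 4 * sqrt (v n * ln (real n + 2))" for n J
  proof -
    define L where "L = ln (real n + 2)"
    define s where "s = \<bar>\<Sum>j<J. Z n j a\<bar>"
    have L: "L > 0"
      by (simp add: L_def)
    have l_pos: "l n > 0"
      using v[of n] L by (simp add: l_def L_def)
    have l_sq: "(l n)\<^sup>2 = L / v n"
      using v[of n] L by (simp add: l_def L_def)
    have "(\<Sum>m<Suc n. \<phi> m J (f J)) \<le> 1"
      using f(1)[of J] unfolding inv_def by blast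
    moreover have "(\<Sum>m<n. \<phi> m J (f J)) \<ge> 0"
      by (intro sum_nonneg \<phi>_nonneg)
    ultimately have "\<phi> n J (f J) \<le> 1"
      by simp
    then have \<phi>1: "\<phi> n J a \<le> 1"
      using \<phi>_local[of J "f J" a n] agree by simp
    \<comment> \<open>The exponent \<open>7 / 2\<close> arises as 2 from the weight
      \<open>w n\<close>, \<open>1 / 2\<close> from the compensator and 1 from absorbing the factor
      2 into \<open>exp L = n + 2\<close>.\<close>
    have "exp (l n * s) \<le> 2 * cosh (l n * s)"
      by (simp add: cosh_def)
    also have "cosh (l n * s) = cosh (l n * (\<Sum>j<J. Z n j a))"
      by (simp add: s_def abs_if)
    also have "\<dots> = \<phi> n J a / w n * exp ((l n)\<^sup>2 / 2 * (\<Sum>j<J. (c n j)\<^sup>2))"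
      using w_pos[of n] by (simp add: \<phi>_def exp_minus field_simps)
    also have "\<dots> \<le> 1 / w n * exp ((l n)\<^sup>2 / 2 * v n)"
      using w_pos[of n] \<phi>1 var by (intro mult_mono divide_right_mono) (auto intro!: mult_left_mono)
    also have "1 / w n \<le> exp (2 * L)"
    proof -
      have "exp (2 * L) = exp L * exp L"
        by (simp flip: exp_add)
      also have "exp L = real n + 2"
        by (simp add: L_def)
      finally show ?thesis
        by (simp add: w_def algebra_simps)
    qed
    also have "(l n)\<^sup>2 / 2 * v n = L / 2"
      using v[of n] by (simp add: l_sq)
    also have "2 * (exp (2 * L) * exp (L / 2)) \<le> exp L * (exp (2 * L) * exp (L / 2))"
      by (intro mult_right_mono) (auto simp: L_def)
    also have "\<dots> = exp (7 / 2 * L)"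
      by (simp add: algebra_simps flip: exp_add)
    finally have "l n * s \<le> 7 / 2 * L"
      by simp
    also have "\<dots> \<le> 4 * L"
      using L by simp
    also have "L = l n * sqrt (v n * L)"
    proof -
      have "l n * sqrt (v n * L) = sqrt (L / v n * (v n * L))"
        by (simp add: l_def L_def flip: real_sqrt_mult)
      also have "L / v n * (v n * L) = L * L"
        using v[of n] by simp
      finally show ?thesis
        using L by simp
    qed
    finally have "l n * s \<le> l n * (4 * sqrt (v n * L))"
      by simp
    then show ?thesis
      using l_pos by (simp add: s_def L_def)
  qed
  then show ?thesis
    using aS by blast
qed

section \<open>One element from each slice\<close>

lemma sum_powr_le:
  assumes "0 < a" "a \<le> 1"
  shows "(\<Sum>m=1..n. real m powr (a - 1)) \<le> real n powr a / a"
proof (induction n)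
  case (Suc n)
  have step: "real (Suc n) powr (a - 1) \<le> (real (Suc n) powr a - real n powr a) / a"
  proof (cases "n = 0")
    case False
    then have "\<exists>z. real n < z \<and> z < real (Suc n) \<and>
        real (Suc n) powr a - real n powr a = (real (Suc n) - real n) * (a * z powr (a - 1))"
      by (intro MVT2) (auto intro!: derivative_eq_intros)
    then obtain z where z: "real n < z" "z < real (Suc n)"
        "real (Suc n) powr a - real n powr a = a * z powr (a - 1)"
      by auto
    have "real (Suc n) powr (a - 1) \<le> z powr (a - 1)"
      using z False assms by (intro powr_mono2') auto
    then show ?thesis
      using z assms by simp
  qed (use assms in simp)
  have "(\<Sum>m=1..Suc n. real m powr (a - 1)) = (\<Sum>m=1..n. real m powr (a - 1)) + real (Suc n) powr (a - 1)"
    by simp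
  also have "\<dots> \<le> real n powr a / a + (real (Suc n) powr a - real n powr a) / a"
    using Suc step by (rule add_mono)
  finally show ?case
    by (simp add: diff_divide_distrib)
qed (use assms in simp)

text \<open>For sums over slices of which at most one is active, so that the bound does not grow
  with their number.\<close>

lemma abs_sum_le_of_at_most_one:
  fixes f :: "'a \<Rightarrow> real"
  assumes "\<And>i j. i \<in> A \<Longrightarrow> j \<in> A \<Longrightarrow> f i \<noteq> 0 \<Longrightarrow> f j \<noteq> 0 \<Longrightarrow> i = j"
    and "\<And>i. i \<in> A \<Longrightarrow> \<bar>f i\<bar> \<le> B" and "B \<ge> 0"
  shows "\<bar>\<Sum>i\<in>A. f i\<bar> \<le> B"
proof (cases "finite A \<and> (\<exists>i\<in>A. f i \<noteq> 0)")
  case True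
  then obtain i where i: "i \<in> A" "f i \<noteq> 0"
    by blast
  have "(\<Sum>j\<in>A. f j) = (\<Sum>j\<in>{i}. f j)"
    using True i assms(1) by (intro sum.mono_neutral_right) auto
  then show ?thesis
    using assms(2)[OF i(1)] by simp
next
  case False
  then have "(\<Sum>i\<in>A. f i) = 0"
    by (cases "finite A") auto
  then show ?thesis
    using assms(3) by simp
qed

lemma fps_mult_nth_cong_left:
  assumes "\<And>m. m \<le> n \<Longrightarrow> F $ m = F' $ m"
  shows "(F * K) $ n = (F' * K) $ n"
  using assms by (simp add: fps_mult_nth)

text \<open>The generating function $A$ of the sequence, with multiplicity: a value that belongs to
  several slices may be chosen repeatedly.\<close>

definition value_series :: "(nat \<Rightarrow> nat) \<Rightarrow> real fps" where
  "value_series a = Abs_fps (\<lambda>m. real (card {i. a i = m}))"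

text \<open>The choice of the sequence depends only on the order of magnitude of the weights; their
  exact form matters for the main term alone.\<close>

locale weights =
  fixes h :: "nat \<Rightarrow> real" and \<alpha> c C :: real
  assumes \<alpha>: "0 < \<alpha>" "\<alpha> < 1" and c: "0 < c" and h_0: "h 0 = 0"
    and h_lower: "m \<ge> 1 \<Longrightarrow> c * real m powr (\<alpha> - 1) \<le> h m"
    and h_upper: "m \<ge> 1 \<Longrightarrow> h m \<le> C * real m powr (\<alpha> - 1)"
begin

definition W :: "nat \<Rightarrow> real" where
  "W n = (\<Sum>m\<le>n. h m)"

definition H :: "real fps" where
  "H = Abs_fps h"

text \<open>\<open>p j\<close> is the restriction of the weights to the mass in the interval from \<open>j\<close> to \<open>j + 1\<close>, with distribution
  function \<open>M j\<close>; a weight lying across an integer is divided between two or more slices.\<close>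

definition M :: "nat \<Rightarrow> nat \<Rightarrow> real" where
  "M j y = max 0 (min 1 (W y - real j))"

definition p :: "nat \<Rightarrow> nat \<Rightarrow> real" where
  "p j y = M j y - M j (y - 1)"

text \<open>The support of \<open>p j\<close>. Slices share an element when its weight lies across
  an integer. Truncation of \<open>y - 1\<close> at 0 does no harm, since \<open>W 0 = 0\<close>
  keeps 0 out of every slice.\<close>

definition slice :: "nat \<Rightarrow> nat set" where
  "slice j = {y. real j < W y \<and> W (y - 1) < real j + 1}"

text \<open>The centred indicator of the choice \<open>y\<close>; the series $D$ is the formal sum
  of these over all slices.\<close>

definition dev :: "nat \<Rightarrow> nat \<Rightarrow> real fps" where
  "dev j y = Abs_fps (\<lambda>m. (if m = y then 1 else 0) - p j m)"

text \<open>A bound for the contribution of the choice in slice \<open>j\<close> to the \<open>n\<close>-th coefficient of $DHG$.\<close>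

definition crossing :: "nat \<Rightarrow> nat \<Rightarrow> real" where
  "crossing n j = (\<Sum>x | x \<le> n \<and> real j < W x \<and> W x < real j + 1. h (n - x))"

text \<open>A common variance bound, up to a constant: the first summand is for $DHG$, the second,
  the order of the number of slices up to \<open>n\<close>, for $DDG$. The sum over \<open>t\<close>
  stays unevaluated because its size depends on the position of \<open>\<alpha>\<close> relative to
  \<open>1 / 2\<close>.\<close>

definition V :: "nat \<Rightarrow> real" where
  "V n = real n powr (2 * (\<alpha> * (1 - \<alpha>))) * (\<Sum>t=1..Suc (nat \<lfloor>W n\<rfloor>). real t powr (2 * \<alpha> - 2)) + real n powr \<alpha>"

section \<open>Growth of the summatory function \<open>W\<close> and gaps between its values\<close>

lemma h_nonneg: "h m \<ge> 0"
proof (cases "m = 0")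
  case False
  then have "0 \<le> c * real m powr (\<alpha> - 1)"
    using c by simp
  also have "\<dots> \<le> h m"
    using False by (intro h_lower) simp
  finally show ?thesis .
qed (simp add: h_0)

lemma C_pos: "C > 0"
  using h_lower[of 1] h_upper[of 1] c by simp

lemma W_0: "W 0 = 0"
  by (simp add: W_def h_0)

lemma W_Suc: "W (Suc n) = W n + h (Suc n)"
  by (simp add: W_def)

lemma W_mono: "x \<le> y \<Longrightarrow> W x \<le> W y"
  unfolding W_def by (intro sum_mono2) (auto simp: h_nonneg)

lemma W_less_imp: "W x < W y \<Longrightarrow> x < y"
  using W_mono[of y x] by linarith

lemma W_nonneg: "W x \<ge> 0"
  using W_mono[of 0 x] by (simp add: W_0)

lemma W_diff: "x \<le> y \<Longrightarrow> W y - W x = (\<Sum>m\<in>{x<..y}. h m)"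
proof -
  assume "x \<le> y"
  then have "{..y} = {..x} \<union> {x<..y}"
    by auto
  then have "W y = W x + (\<Sum>m\<in>{x<..y}. h m)"
    unfolding W_def by (simp add: sum.union_disjoint ivl_disj_int)
  then show ?thesis
    by simp
qed

lemma W_upper: "W n \<le> C / \<alpha> * real n powr \<alpha>"
proof -
  have "W n = (\<Sum>m=1..n. h m)"
    using W_diff[of 0 n] by (simp add: W_0 atLeastSucAtMost_greaterThanAtMost)
  also have "\<dots> \<le> (\<Sum>m=1..n. C * real m powr (\<alpha> - 1))"
    by (intro sum_mono h_upper) simp
  also have "\<dots> \<le> C * (real n powr \<alpha> / \<alpha>)"
    unfolding sum_distrib_left[symmetric] using \<alpha> C_pos by (intro mult_left_mono sum_powr_le) auto
  finally show ?thesis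
    by simp
qed

lemma W_diff_lower:
  assumes "x \<le> y" "y \<le> n"
  shows "(real y - real x) * (c * real n powr (\<alpha> - 1)) \<le> W y - W x"
proof -
  have "(real y - real x) * (c * real n powr (\<alpha> - 1)) = (\<Sum>m\<in>{x<..y}. c * real n powr (\<alpha> - 1))"
    using assms by simp
  also have "\<dots> \<le> (\<Sum>m\<in>{x<..y}. h m)"
  proof (rule sum_mono)
    fix m assume m: "m \<in> {x<..y}"
    then have "c * real n powr (\<alpha> - 1) \<le> c * real m powr (\<alpha> - 1)"
      using c \<alpha> assms by (intro mult_left_mono powr_mono2') auto
    also have "\<dots> \<le> h m"
      using m by (intro h_lower) auto
    finally show "c * real n powr (\<alpha> - 1) \<le> h m" .
  qed
  finally show ?thesis
    using W_diff[OF assms(1)] by simp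
qed

lemma powr_one_minus: "n \<ge> 1 \<Longrightarrow> real n powr (1 - \<alpha>) * real n powr (\<alpha> - 1) = 1"
  by (simp flip: powr_add)

lemma gap_upper:
  assumes "x \<le> y" "y \<le> n" "n \<ge> 1"
  shows "real y - real x \<le> (W y - W x) * real n powr (1 - \<alpha>) / c"
proof -
  have "(real y - real x) * c = (real y - real x) * (c * real n powr (\<alpha> - 1)) * real n powr (1 - \<alpha>)"
    using powr_one_minus[OF assms(3)] by (simp add: mult_ac)
  also have "\<dots> \<le> (W y - W x) * real n powr (1 - \<alpha>)"
    using W_diff_lower[OF assms(1,2)] by (rule mult_right_mono) simp
  finally show ?thesis
    using c by (simp add: field_simps)
qed

text \<open>The density near \<open>n\<close> is about \<open>n powr (\<alpha> - 1)\<close>. In the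
  upper half the weights exceed \<open>C * n powr (\<alpha> - 1)\<close> by at most a factor 2; for
  smaller \<open>x\<close> the total mass \<open>W n\<close> is already small enough, as
  \<open>n - x > n / 2\<close>.\<close>

lemma gap_lower:
  assumes "x \<le> n" "n \<ge> 1"
  shows "(W n - W x) * real n powr (1 - \<alpha>) \<le> 2 * C / \<alpha> * (real n - real x)"
proof -
  have C_le: "2 * C \<le> 2 * C / \<alpha>"
    using \<alpha> C_pos by (simp add: field_simps)
  have "W n - W x \<le> 2 * C / \<alpha> * (real n - real x) * real n powr (\<alpha> - 1)"
  proof (cases "n \<le> 2 * x")
    case True
    have "W n - W x = (\<Sum>m\<in>{x<..n}. h m)"
      using assms(1) by (rule W_diff)
    also have "\<dots> \<le> (\<Sum>m\<in>{x<..n}. 2 * C / \<alpha> * real n powr (\<alpha> - 1))"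
    proof (rule sum_mono)
      fix m assume m: "m \<in> {x<..n}"
      have "h m \<le> C * real m powr (\<alpha> - 1)"
        using m by (intro h_upper) auto
      also have "\<dots> \<le> C * (real n / 2) powr (\<alpha> - 1)"
        using m assms True C_pos \<alpha> by (intro mult_left_mono powr_mono2') auto
      also have "(real n / 2) powr (\<alpha> - 1) = 2 powr (1 - \<alpha>) * real n powr (\<alpha> - 1)"
        using assms by (simp add: powr_divide powr_diff field_simps)
      also have "C * (2 powr (1 - \<alpha>) * real n powr (\<alpha> - 1)) \<le> C * (2 powr 1 * real n powr (\<alpha> - 1))"
        using C_pos \<alpha> by (intro mult_left_mono mult_right_mono powr_mono) auto
      also have "\<dots> \<le> 2 * C / \<alpha> * real n powr (\<alpha> - 1)"
        using mult_right_mono[OF C_le, of "real n powr (\<alpha> - 1)"] by simp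
      finally show "h m \<le> 2 * C / \<alpha> * real n powr (\<alpha> - 1)" .
    qed
    also have "\<dots> = 2 * C / \<alpha> * (real n - real x) * real n powr (\<alpha> - 1)"
      using assms by (simp add: of_nat_diff)
    finally show ?thesis .
  next
    case False
    have "W n - W x \<le> W n"
      using W_nonneg by simp
    also have "\<dots> \<le> C / \<alpha> * real n powr \<alpha>"
      by (rule W_upper)
    also have "real n powr \<alpha> = real n * real n powr (\<alpha> - 1)"
      using assms by (simp add: powr_diff)
    also have "C / \<alpha> * (real n * real n powr (\<alpha> - 1)) \<le> C / \<alpha> * ((2 * (real n - real x)) * real n powr (\<alpha> - 1))"
      using False C_pos \<alpha> by (intro mult_left_mono mult_right_mono) auto
    finally show ?thesis
      by (simp add: mult_ac)
  qed
  then have "(W n - W x) * real n powr (1 - \<alpha>) \<le>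
      2 * C / \<alpha> * (real n - real x) * real n powr (\<alpha> - 1) * real n powr (1 - \<alpha>)"
    by (rule mult_right_mono) simp
  also have "\<dots> = 2 * C / \<alpha> * (real n - real x) * (real n powr (1 - \<alpha>) * real n powr (\<alpha> - 1))"
    by (simp only: mult_ac)
  finally show ?thesis
    by (simp only: powr_one_minus[OF assms(2)] mult_1_right)
qed

lemma W_unbounded: "\<exists>n. t \<le> W n"
proof -
  have "filterlim (\<lambda>n::nat. c * real n powr \<alpha>) at_top sequentially"
    using c \<alpha> by real_asymp
  then have "eventually (\<lambda>n::nat. t \<le> c * real n powr \<alpha>) sequentially"
    by (simp add: filterlim_at_top)
  then have "eventually (\<lambda>n. t \<le> W n) sequentially"
    using eventually_ge_at_top[of 1]
  proof eventually_elim
    case (elim n)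
    have "real n powr \<alpha> = real n * real n powr (\<alpha> - 1)"
      using elim by (simp add: powr_diff)
    then have "c * real n powr \<alpha> \<le> W n"
      using W_diff_lower[of 0 n n] by (simp add: W_0 mult_ac)
    then show ?case
      using elim by linarith
  qed
  then show ?thesis
    by (auto simp: eventually_sequentially)
qed

section \<open>Slices and centred deviations\<close>

lemma p_nonneg: "p j y \<ge> 0"
  using W_mono[of "y - 1" y] by (simp add: p_def M_def)

lemma p_eq_0: "y \<notin> slice j \<Longrightarrow> p j y = 0"
  using W_mono[of "y - 1" y] by (auto simp: p_def M_def slice_def)

lemma sum_p: "(\<Sum>y\<le>x. p j y) = M j x"
  by (induction x) (simp_all add: p_def M_def W_0)

lemma M_bounds: "0 \<le> M j x" "M j x \<le> 1"
  by (simp_all add: M_def)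

lemma slice_subset:
  assumes "real j + 1 \<le> W n"
  shows "slice j \<subseteq> {..n}"
proof
  fix y assume "y \<in> slice j"
  then have "W (y - 1) < W n"
    using assms by (simp add: slice_def)
  then have "y - 1 < n"
    by (rule W_less_imp)
  then show "y \<in> {..n}"
    by simp
qed

lemma finite_slice: "finite (slice j)"
  using W_unbounded[of "real j + 1"] slice_subset finite_subset by blast

lemma sum_p_slice: "(\<Sum>y\<in>slice j. p j y) = 1"
proof -
  obtain n where n: "real j + 1 \<le> W n"
    using W_unbounded by blast
  have "(\<Sum>y\<in>slice j. p j y) = (\<Sum>y\<le>n. p j y)"
    using slice_subset[OF n] p_eq_0 by (intro sum.mono_neutral_left) auto
  also have "\<dots> = 1"
    using n by (simp add: sum_p M_def)
  finally show ?thesis .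
qed

text \<open>The martingale property: \<open>F\<close> may be any series that is fixed before the
  choice in slice \<open>j\<close>, such as one built from earlier choices.\<close>

lemma mean_dev: "(\<Sum>y\<in>slice j. p j y * (dev j y * F) $ n) = 0"
proof -
  have zero: "(\<Sum>y\<in>slice j. p j y * dev j y $ m) = 0" for m
  proof -
    have "(\<Sum>y\<in>slice j. p j y * dev j y $ m) =
        (\<Sum>y\<in>slice j. if m = y then p j y else 0) - (\<Sum>y\<in>slice j. p j y) * p j m"
      unfolding sum_distrib_right sum_subtractf[symmetric]
      by (intro sum.cong) (auto simp: dev_def algebra_simps)
    also have "(\<Sum>y\<in>slice j. if m = y then p j y else 0) = p j m"
      using p_eq_0[of m j] by (simp add: finite_slice)
    finally show ?thesis
      by (simp add: sum_p_slice)
  qed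
  have "(\<Sum>y\<in>slice j. p j y * (dev j y * F) $ n) = (\<Sum>y\<in>slice j. \<Sum>i=0..n. p j y * dev j y $ i * F $ (n - i))"
    by (simp add: fps_mult_nth sum_distrib_left mult.assoc)
  also have "\<dots> = (\<Sum>i=0..n. (\<Sum>y\<in>slice j. p j y * dev j y $ i) * F $ (n - i))"
    by (subst sum.swap) (simp add: sum_distrib_right)
  finally show ?thesis
    by (simp add: zero)
qed

lemma dev_eq_0: "y \<in> slice j \<Longrightarrow> m \<notin> slice j \<Longrightarrow> dev j y $ m = 0"
  by (auto simp: dev_def p_eq_0)

lemma cum_dev: "(dev j y * inv_pow 1) $ x = (if y \<le> x then 1 else 0) - M j x"
  by (simp add: inv_pow_mult_1_nth dev_def sum_subtractf sum_p)

text \<open>The distribution functions of the point \<open>y\<close> and of \<open>p j\<close> are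
  both 0 before the slice and 1 after it. Thanks to the strict inequalities the ranges of
  \<open>x\<close> left for different \<open>j\<close> are disjoint, although the slices need not
  be.\<close>

lemma cum_dev_eq_0:
  assumes "y \<in> slice j" "\<not> (real j < W x \<and> W x < real j + 1)"
  shows "(dev j y * inv_pow 1) $ x = 0"
proof (cases "W x \<le> real j")
  case True
  then have "x < y"
    using assms(1) by (intro W_less_imp) (simp add: slice_def)
  then show ?thesis
    using True by (simp add: cum_dev M_def)
next
  case False
  then have "W (y - 1) < W x"
    using assms by (simp add: slice_def)
  then have "y - 1 < x"
    by (rule W_less_imp)
  then show ?thesis
    using False assms(2) by (simp add: cum_dev M_def)
qed

lemma abs_cum_dev_le: "\<bar>(dev j y * inv_pow 1) $ x\<bar> \<le> 1"
  using M_bounds[of j x] by (simp add: cum_dev)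

lemma sum_abs_dev: "(\<Sum>m=0..n. \<bar>dev j y $ m\<bar>) \<le> 2"
proof -
  have "(\<Sum>m=0..n. \<bar>dev j y $ m\<bar>) \<le> (\<Sum>m=0..n. (if m = y then 1 else 0) + p j m)"
    using p_nonneg by (intro sum_mono) (auto simp: dev_def abs_le_iff)
  also have "\<dots> = (\<Sum>m=0..n. if m = y then 1 else 0) + M j n"
    by (simp add: sum.distrib sum_p atLeast0AtMost)
  also have "\<dots> \<le> 1 + 1"
    using M_bounds by (intro add_mono) auto
  finally show ?thesis
    by simp
qed

lemma abs_dev_mult_le:
  assumes "\<And>m. m \<le> n \<Longrightarrow> \<bar>F $ m\<bar> \<le> 1"
  shows "\<bar>(dev j y * F) $ n\<bar> \<le> 2"
proof -
  have "\<bar>(dev j y * F) $ n\<bar> \<le> (\<Sum>m=0..n. \<bar>dev j y $ m\<bar> * \<bar>F $ (n - m)\<bar>)"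
    unfolding fps_mult_nth abs_mult[symmetric] by (rule sum_abs)
  also have "\<dots> \<le> (\<Sum>m=0..n. \<bar>dev j y $ m\<bar> * 1)"
    using assms by (intro sum_mono mult_left_mono) auto
  also have "\<dots> \<le> 2"
    using sum_abs_dev by simp
  finally show ?thesis .
qed

text \<open>The factor $1/(1-X)$ is moved from \<open>H\<close> to \<open>dev j y\<close>, where
  summation leaves a series bounded by 1 and supported inside one slice.\<close>

lemma abs_linear_increment_le:
  assumes "y \<in> slice j"
  shows "\<bar>(dev j y * (H * inv_pow 1)) $ n\<bar> \<le> crossing n j"
proof -
  have "(dev j y * (H * inv_pow 1)) $ n = ((dev j y * inv_pow 1) * H) $ n"
    by (simp add: mult_ac)
  also have "\<dots> = (\<Sum>x=0..n. (dev j y * inv_pow 1) $ x * h (n - x))"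
    by (simp only: fps_mult_nth[of "dev j y * inv_pow 1" H]) (simp add: H_def)
  also have "\<bar>\<dots>\<bar> \<le> (\<Sum>x=0..n. \<bar>(dev j y * inv_pow 1) $ x * h (n - x)\<bar>)"
    by (rule sum_abs)
  also have "\<dots> \<le> (\<Sum>x=0..n. if real j < W x \<and> W x < real j + 1 then h (n - x) else 0)"
  proof (rule sum_mono)
    fix x
    show "\<bar>(dev j y * inv_pow 1) $ x * h (n - x)\<bar> \<le> (if real j < W x \<and> W x < real j + 1 then h (n - x) else 0)"
      using cum_dev_eq_0[OF assms, of x] mult_right_mono[OF abs_cum_dev_le[of j y x] h_nonneg[of "n - x"]] h_nonneg[of "n - x"]
      by (auto simp: abs_mult)
  qed
  also have "\<dots> = crossing n j"
    unfolding crossing_def by (subst sum.inter_filter[symmetric]) (auto intro!: sum.cong)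
  finally show ?thesis .
qed

text \<open>At each \<open>x\<close> only one slice is active, so the deviations of the counting
  function do not accumulate. This is the gain over selecting integers independently, where they
  would grow like the square root of the counting function.\<close>

lemma abs_partial_cum_dev_le:
  assumes "\<And>i. i < j \<Longrightarrow> a i \<in> slice i"
  shows "\<bar>((\<Sum>i<j. dev i (a i)) * inv_pow 1) $ x\<bar> \<le> 1"
proof -
  have "((\<Sum>i<j. dev i (a i)) * inv_pow 1) $ x = (\<Sum>i<j. (dev i (a i) * inv_pow 1) $ x)"
    by (simp add: sum_distrib_right fps_sum_nth)
  also have "\<bar>\<dots>\<bar> \<le> 1"
  proof (rule abs_sum_le_of_at_most_one[OF _ abs_cum_dev_le])
    fix i i' assume i: "i \<in> {..<j}" "i' \<in> {..<j}" "(dev i (a i) * inv_pow 1) $ x \<noteq> 0" "(dev i' (a i') * inv_pow 1) $ x \<noteq> 0"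
    then have "real i < W x" "W x < real i + 1" "real i' < W x" "W x < real i' + 1"
      using cum_dev_eq_0[of "a i" i x] cum_dev_eq_0[of "a i'" i' x] assms by auto
    then show "i = i'"
      by linarith
  qed simp
  finally show ?thesis .
qed

lemma abs_quadratic_increment_le:
  assumes "\<And>i. i \<le> j \<Longrightarrow> a i \<in> slice i"
  shows "\<bar>(dev j (a j) * ((\<Sum>i<j. dev i (a i)) * inv_pow 1)) $ n\<bar> \<le> (if real j < W n then 2 else 0)"
proof (cases "real j < W n")
  case True
  then show ?thesis
    using assms by (simp add: abs_dev_mult_le abs_partial_cum_dev_le)
next
  case False
  have "dev j (a j) $ m = 0" if "m \<le> n" for m
    using dev_eq_0[OF assms[of j], of m] W_mono[OF that] False by (auto simp: slice_def)
  then show ?thesis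
    using False by (simp add: fps_mult_nth)
qed

text \<open>A nonzero term writes \<open>n\<close> as a sum of two numbers from slice
  \<open>j\<close>, and such sums increase with the slice, so at most one \<open>j\<close>
  contributes. The summand \<open>m\<close> may be shared by two slices; the strict increase comes
  from \<open>n - m\<close>, at which the summed deviation must not vanish.\<close>

lemma abs_diagonal_le:
  assumes "\<And>i. a i \<in> slice i"
  shows "\<bar>\<Sum>j<J. (dev j (a j) * (dev j (a j) * inv_pow 1)) $ n\<bar> \<le> 2"
proof (rule abs_sum_le_of_at_most_one)
  show "\<bar>(dev j (a j) * (dev j (a j) * inv_pow 1)) $ n\<bar> \<le> 2" for j
    by (intro abs_dev_mult_le abs_cum_dev_le)
  have witness: "\<exists>m\<le>n. W (m - 1) < real j + 1 \<and> real j < W m \<and> real j < W (n - m) \<and> W (n - m) < real j + 1"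
    if "(dev j (a j) * (dev j (a j) * inv_pow 1)) $ n \<noteq> 0" for j
  proof -
    have "(\<Sum>m=0..n. dev j (a j) $ m * (dev j (a j) * inv_pow 1) $ (n - m)) \<noteq> 0"
      using that by (simp only: fps_mult_nth[of "dev j (a j)" "dev j (a j) * inv_pow 1"] not_False_eq_True)
    then obtain m where "m \<in> {0..n}" "dev j (a j) $ m * (dev j (a j) * inv_pow 1) $ (n - m) \<noteq> 0"
      using sum.not_neutral_contains_not_neutral by blast
    then have m: "m \<le> n" "dev j (a j) $ m \<noteq> 0" "(dev j (a j) * inv_pow 1) $ (n - m) \<noteq> 0"
      by auto
    then show ?thesis
      using dev_eq_0[OF assms, of m j] cum_dev_eq_0[OF assms, of j "n - m"] by (auto simp: slice_def)
  qed
  have le: "j' \<le> j" if nz: "(dev j (a j) * (dev j (a j) * inv_pow 1)) $ n \<noteq> 0"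
    and nz': "(dev j' (a j') * (dev j' (a j') * inv_pow 1)) $ n \<noteq> 0" for j j'
  proof (rule ccontr)
    assume "\<not> j' \<le> j"
    then have "real j + 1 \<le> real j'"
      by linarith
    moreover obtain m where "m \<le> n" "W (m - 1) < real j + 1" "W (n - m) < real j + 1"
      using witness[OF nz] by blast
    moreover obtain m' where "m' \<le> n" "real j' < W m'" "real j' < W (n - m')"
      using witness[OF nz'] by blast
    ultimately have "m - 1 < m'" "n - m < n - m'" "m \<le> n" "m' \<le> n"
      by (auto intro!: W_less_imp)
    then show False
      by linarith
  qed
  show "j = j'" if "(dev j (a j) * (dev j (a j) * inv_pow 1)) $ n \<noteq> 0"
    "(dev j' (a j') * (dev j' (a j') * inv_pow 1)) $ n \<noteq> 0" for j j'
    using le[OF that] le[OF that(2,1)] by simp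
qed simp

section \<open>Variance of the increments\<close>

lemma crossing_eq_0: "W n \<le> real j \<Longrightarrow> crossing n j = 0"
  unfolding crossing_def by (intro sum.neutral) (use W_mono in force)

lemma crossing_nonneg: "crossing n j \<ge> 0"
  by (simp add: crossing_def sum_nonneg h_nonneg)

text \<open>A slice below \<open>n\<close> has length \<open>O(r)\<close> with
  \<open>r = n powr (1 - \<alpha>)\<close>, and a slice at a distance of \<open>u\<close> slices
  from \<open>n\<close> lies at least of order \<open>u * r\<close> away. This gives \<open>r * (u *
  r) powr (\<alpha> - 1) = r powr \<alpha> * u powr (\<alpha> - 1)\<close>, up to a
  constant.\<close>

lemma crossing_le:
  "\<exists>K>0. \<forall>n\<ge>1. \<forall>j. real j < W n \<longrightarrow>
    crossing n j \<le> K * real n powr (\<alpha> * (1 - \<alpha>)) * (W n - real j + 1) powr (\<alpha> - 1)"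
proof -
  define \<kappa> where "\<kappa> = 2 * C / \<alpha>"
  define K1 where "K1 = (1 / c + 1) * (C * (3 * \<kappa>) powr (1 - \<alpha>))"
  define K2 where "K2 = C / \<alpha> * (2 / c) powr \<alpha> * 3 powr (1 - \<alpha>)"
  have \<kappa>: "\<kappa> > 0"
    using C_pos \<alpha> by (simp add: \<kappa>_def)
  have K1: "K1 > 0" and K2: "K2 > 0"
    using C_pos \<alpha> c \<kappa> by (simp_all add: K1_def K2_def add_pos_pos)
  have "crossing n j \<le> (K1 + K2) * real n powr (\<alpha> * (1 - \<alpha>)) * (W n - real j + 1) powr (\<alpha> - 1)"
    if n: "n \<ge> 1" and j: "real j < W n" for n j
  proof -
    define r where "r = real n powr (1 - \<alpha>)"
    define E where "E = {x. x \<le> n \<and> real j < W x \<and> W x < real j + 1}"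
    define u where "u = W n - real j + 1"
    have u: "u > 1"
      using j by (simp add: u_def)
    have r: "r \<ge> 1"
      using n \<alpha> by (simp add: r_def ge_one_powr_ge_zero)
    have r_powr: "r powr \<alpha> = real n powr (\<alpha> * (1 - \<alpha>))"
      by (simp add: r_def powr_powr mult.commute)
    have finE: "finite E"
      by (simp add: E_def)
    have "crossing n j \<le> (K1 + K2) * r powr \<alpha> * u powr (\<alpha> - 1)"
    \<comment> \<open>For \<open>x\<close> in the slice, \<open>W n - W x > u - 2\<close>, and this
      is at least \<open>u / 3\<close> once \<open>u \<ge> 3\<close>.\<close>
    proof (cases "u > 3")
      case True
      have card_E: "real (card E) \<le> (1 / c + 1) * r"
      proof (cases "E = {}")
        case False
        define x0 x1 where "x0 = Min E" and "x1 = Max E"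
        have x: "x0 \<in> E" "x1 \<in> E" "x0 \<le> x1" "E \<subseteq> {x0..x1}"
          using finE False by (auto simp: x0_def x1_def)
        then have "card E \<le> x1 - x0 + 1"
          using card_mono[of "{x0..x1}" E] by simp
        then have "real (card E) \<le> real x1 - real x0 + 1"
          using x(3) by linarith
        also have "real x1 - real x0 \<le> (W x1 - W x0) * r / c"
          unfolding r_def using x by (intro gap_upper n) (auto simp: E_def)
        also have "\<dots> \<le> 1 * r / c"
          using x c r by (intro divide_right_mono mult_right_mono) (auto simp: E_def)
        also have "1 * r / c + 1 \<le> (1 / c + 1) * r"
          using r by (simp add: algebra_simps)
        finally show ?thesis
          by simp
      qed (use c r in simp)
      have h_le: "h (n - x) \<le> C * (3 * \<kappa>) powr (1 - \<alpha>) * (r powr (\<alpha> - 1) * u powr (\<alpha> - 1))" if "x \<in> E" for x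
      proof -
        have x: "x \<le> n" "W x < real j + 1"
          using that by (auto simp: E_def)
        have "u / 3 * r \<le> (W n - W x) * r"
          using x True r by (intro mult_right_mono) (auto simp: u_def)
        also have "\<dots> \<le> \<kappa> * (real n - real x)"
          unfolding r_def \<kappa>_def using x n by (intro gap_lower)
        finally have gap: "u * r / (3 * \<kappa>) \<le> real (n - x)"
          using x \<kappa> by (simp add: field_simps of_nat_diff)
        moreover have pos: "u * r / (3 * \<kappa>) > 0"
          using u r \<kappa> by simp
        ultimately have "n - x \<ge> 1"
          by (cases "n - x") auto
        then have "h (n - x) \<le> C * real (n - x) powr (\<alpha> - 1)"
          by (rule h_upper)
        also have "\<dots> \<le> C * (u * r / (3 * \<kappa>)) powr (\<alpha> - 1)"
          using gap pos \<alpha> C_pos by (intro mult_left_mono powr_mono2') auto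
        also have "(u * r / (3 * \<kappa>)) powr (\<alpha> - 1) = (3 * \<kappa>) powr (1 - \<alpha>) * (r powr (\<alpha> - 1) * u powr (\<alpha> - 1))"
        proof -
          have "(3 * \<kappa>) powr (1 - \<alpha>) = 1 / (3 * \<kappa>) powr (\<alpha> - 1)"
            using powr_minus_divide[of "3 * \<kappa>" "\<alpha> - 1"] by simp
          then show ?thesis
            using u r \<kappa> by (simp add: powr_divide powr_mult)
        qed
        finally show ?thesis
          by (simp add: mult_ac)
      qed
      have "crossing n j \<le> (\<Sum>x\<in>E. C * (3 * \<kappa>) powr (1 - \<alpha>) * (r powr (\<alpha> - 1) * u powr (\<alpha> - 1)))"
        unfolding crossing_def E_def[symmetric] by (intro sum_mono h_le)
      also have "\<dots> = real (card E) * (C * (3 * \<kappa>) powr (1 - \<alpha>) * (r powr (\<alpha> - 1) * u powr (\<alpha> - 1)))"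
        by simp
      also have "\<dots> \<le> ((1 / c + 1) * r) * (C * (3 * \<kappa>) powr (1 - \<alpha>) * (r powr (\<alpha> - 1) * u powr (\<alpha> - 1)))"
        using card_E C_pos by (intro mult_right_mono) auto
      also have "\<dots> = K1 * (r * r powr (\<alpha> - 1)) * u powr (\<alpha> - 1)"
        by (simp add: K1_def)
      also have "r * r powr (\<alpha> - 1) = r powr \<alpha>"
        using r by (simp add: powr_diff)
      also have "K1 * r powr \<alpha> * u powr (\<alpha> - 1) \<le> (K1 + K2) * r powr \<alpha> * u powr (\<alpha> - 1)"
        using K2 by (intro mult_right_mono) auto
      finally show ?thesis .
    next
      case False
      \<comment> \<open>Near \<open>n\<close> the distance \<open>n - x\<close> may be tiny and
        gives no useful pointwise bound on \<open>h (n - x)\<close>. But all these distances are at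
        most \<open>Y = O(r)\<close>, so the weights add up to at most \<open>W Y\<close>. The power
        of 3 in \<open>K2\<close> makes up for \<open>u powr (\<alpha> - 1)\<close>, as
        \<open>u \<le> 3\<close>.\<close>
      define Y where "Y = nat \<lfloor>2 * r / c\<rfloor>"
      have Y: "n - x \<le> Y" if "x \<in> E" for x
      proof -
        have x: "x \<le> n" "W n - W x \<le> 2"
          using that False by (auto simp: E_def u_def)
        have "real n - real x \<le> (W n - W x) * r / c"
          unfolding r_def using x n by (intro gap_upper) auto
        also have "\<dots> \<le> 2 * r / c"
          using x c r by (intro divide_right_mono mult_right_mono) auto
        finally show ?thesis
          using x unfolding Y_def by (simp add: le_nat_floor of_nat_diff)
      qed
      have "crossing n j = (\<Sum>y\<in>(\<lambda>x. n - x) ` E. h y)"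
        unfolding crossing_def E_def[symmetric]
        by (subst sum.reindex) (auto simp: inj_on_def E_def)
      also have "\<dots> \<le> W Y"
        unfolding W_def using Y h_nonneg by (intro sum_mono2) auto
      also have "\<dots> \<le> C / \<alpha> * real Y powr \<alpha>"
        by (rule W_upper)
      also have "\<dots> \<le> C / \<alpha> * (2 * r / c) powr \<alpha>"
        using C_pos \<alpha> r c by (intro mult_left_mono powr_mono2) (auto simp: Y_def)
      also have "(2 * r / c) powr \<alpha> = (2 / c) powr \<alpha> * r powr \<alpha>"
        using r c by (simp add: powr_mult powr_divide)
      also have "C / \<alpha> * ((2 / c) powr \<alpha> * r powr \<alpha>) = K2 * r powr \<alpha> * 3 powr (\<alpha> - 1)"
      proof -
        have "3 powr (1 - \<alpha>) * 3 powr (\<alpha> - 1) = (1 :: real)"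
          by (simp flip: powr_add)
        then show ?thesis
          by (simp add: K2_def)
      qed
      also have "\<dots> \<le> (K1 + K2) * r powr \<alpha> * u powr (\<alpha> - 1)"
      proof (rule mult_mono)
        show "3 powr (\<alpha> - 1) \<le> u powr (\<alpha> - 1)"
          using False u \<alpha> by (intro powr_mono2') auto
      qed (use K1 K2 in \<open>auto intro!: mult_right_mono\<close>)
      finally show ?thesis .
    qed
    then show ?thesis
      by (simp add: u_def r_powr)
  qed
  then show ?thesis
    using K1 K2 by (intro exI[of _ "K1 + K2"]) auto
qed

lemma V_ge_1: "n \<ge> 1 \<Longrightarrow> V n \<ge> 1"
proof -
  assume "n \<ge> 1"
  then have "real n powr \<alpha> \<ge> 1"
    using \<alpha> by (simp add: ge_one_powr_ge_zero)
  moreover have "V n \<ge> real n powr \<alpha>"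
    by (simp add: V_def sum_nonneg)
  ultimately show ?thesis
    by linarith
qed

lemma crossing_variance: "\<exists>K>0. \<forall>n\<ge>1. \<forall>J. (\<Sum>j<J. (crossing n j)\<^sup>2) \<le> K * V n"
proof -
  obtain K where K: "K > 0" "\<And>n j. n \<ge> 1 \<Longrightarrow> real j < W n \<Longrightarrow>
      crossing n j \<le> K * real n powr (\<alpha> * (1 - \<alpha>)) * (W n - real j + 1) powr (\<alpha> - 1)"
    using crossing_le by blast
  have "(\<Sum>j<J. (crossing n j)\<^sup>2) \<le> K\<^sup>2 * V n" if n: "n \<ge> 1" for n J
  proof -
    \<comment> \<open>Slice \<open>j\<close> is renumbered as \<open>t = Suc N - j\<close>, which is
      at least 1; the summand 1 in \<open>crossing_le\<close> provides for this shift.\<close>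
    define N where "N = nat \<lfloor>W n\<rfloor>"
    have N: "real N \<le> W n"
      using W_nonneg[of n] by (simp add: N_def)
    define g where "g t = real t powr (2 * \<alpha> - 2)" for t :: nat
    define B where "B = K\<^sup>2 * real n powr (2 * (\<alpha> * (1 - \<alpha>)))"
    have sq: "(crossing n j)\<^sup>2 \<le> B * g (Suc N - j)" if "real j < W n" for j
    proof -
      have "j \<le> N"
        using that by (simp add: N_def le_nat_floor)
      then have t: "real (Suc N - j) = real N - real j + 1" "real (Suc N - j) \<ge> 1"
        by (simp_all add: of_nat_diff)
      have "crossing n j \<le> K * real n powr (\<alpha> * (1 - \<alpha>)) * (W n - real j + 1) powr (\<alpha> - 1)"
        using K(2) n that by blast
      also have "\<dots> \<le> K * real n powr (\<alpha> * (1 - \<alpha>)) * real (Suc N - j) powr (\<alpha> - 1)"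
        using t N K(1) \<alpha> by (intro mult_left_mono powr_mono2') auto
      finally have "(crossing n j)\<^sup>2 \<le> (K * real n powr (\<alpha> * (1 - \<alpha>)) * real (Suc N - j) powr (\<alpha> - 1))\<^sup>2"
        by (rule power_mono[OF _ crossing_nonneg])
      also have "\<dots> = B * g (Suc N - j)"
      proof -
        have "(x powr e)\<^sup>2 = x powr (2 * e)" for x e :: real
          by (simp add: power2_eq_square flip: powr_add)
        then show ?thesis
          by (simp add: B_def g_def power_mult_distrib algebra_simps)
      qed
      finally show ?thesis .
    qed
    have "(\<Sum>j<J. (crossing n j)\<^sup>2) = (\<Sum>j\<in>{j. j < J \<and> real j < W n}. (crossing n j)\<^sup>2)"
    proof (rule sum.mono_neutral_right)
      show "\<forall>j\<in>{..<J} - {j. j < J \<and> real j < W n}. (crossing n j)\<^sup>2 = 0"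
      proof
        fix j assume "j \<in> {..<J} - {j. j < J \<and> real j < W n}"
        then have "W n \<le> real j"
          by auto
        then show "(crossing n j)\<^sup>2 = 0"
          by (simp add: crossing_eq_0)
      qed
    qed auto
    also have "\<dots> \<le> (\<Sum>j\<in>{j. j < J \<and> real j < W n}. B * g (Suc N - j))"
      by (intro sum_mono sq) auto
    also have "\<dots> \<le> (\<Sum>j\<le>N. B * g (Suc N - j))"
      by (intro sum_mono2) (auto simp: B_def g_def N_def le_nat_floor)
    also have "\<dots> = B * (\<Sum>j\<le>N. g (Suc N - j))"
      by (simp add: sum_distrib_left)
    also have "(\<Sum>j\<le>N. g (Suc N - j)) = (\<Sum>t=1..Suc N. g t)"
      by (rule sum.reindex_bij_witness[of _ "\<lambda>t. Suc N - t" "\<lambda>j. Suc N - j"]) auto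
    also have "B * (\<Sum>t=1..Suc N. g t) \<le> K\<^sup>2 * V n"
      by (simp add: B_def V_def g_def N_def algebra_simps)
    finally show ?thesis .
  qed
  then show ?thesis
    using K(1) by (intro exI[of _ "K\<^sup>2"]) auto
qed

lemma quadratic_variance:
  "\<exists>K>0. \<forall>n\<ge>1. \<forall>J. (\<Sum>j<J. (if real j < W n then 2 else 0 :: real)\<^sup>2) \<le> K * V n"
proof -
  have "(\<Sum>j<J. (if real j < W n then 2 else 0 :: real)\<^sup>2) \<le> 4 * (C / \<alpha> + 1) * V n" if n: "n \<ge> 1" for n J
  proof -
    have "(\<Sum>j<J. (if real j < W n then 2 else 0 :: real)\<^sup>2) = (\<Sum>j\<in>{j. j < J \<and> real j < W n}. 4)"
      by (rule sum.mono_neutral_cong_right) auto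
    also have "\<dots> \<le> (\<Sum>j\<le>nat \<lfloor>W n\<rfloor>. 4)"
      by (intro sum_mono2) (auto simp: le_nat_floor)
    also have "\<dots> \<le> 4 * (W n + 1)"
      using W_nonneg[of n] by simp
    also have "\<dots> \<le> 4 * ((C / \<alpha> + 1) * real n powr \<alpha>)"
    proof -
      have "real n powr \<alpha> \<ge> 1"
        using n \<alpha> by (simp add: ge_one_powr_ge_zero)
      then show ?thesis
        using W_upper[of n] by (simp add: distrib_right)
    qed
    also have "\<dots> \<le> 4 * ((C / \<alpha> + 1) * V n)"
      using C_pos \<alpha> by (intro mult_left_mono) (auto simp: V_def sum_nonneg)
    finally show ?thesis
      by (simp only: mult.assoc)
  qed
  then show ?thesis
    using C_pos \<alpha> by (intro exI[of _ "4 * (C / \<alpha> + 1)"]) (auto intro!: add_pos_pos)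
qed

text \<open>One sequence must serve both requirements, so the two families are interleaved by parity
  into a single application of \<open>adaptive_choice\<close>, with \<open>r div 2\<close> in the
  role of \<open>n\<close>.\<close>

lemma adapted_choice:
  "\<exists>a K. (\<forall>i. a i \<in> slice i) \<and> K > 0 \<and> (\<forall>n\<ge>1. \<forall>J.
    \<bar>\<Sum>j<J. (dev j (a j) * (H * inv_pow 1)) $ n\<bar> \<le> K * sqrt (V n * ln (real n + 2)) \<and>
    \<bar>\<Sum>j<J. (dev j (a j) * ((\<Sum>i<j. dev i (a i)) * inv_pow 1)) $ n\<bar> \<le> K * sqrt (V n * ln (real n + 2)))"
proof -
  obtain K1 where K1: "K1 > 0" "\<And>n J. n \<ge> 1 \<Longrightarrow> (\<Sum>j<J. (crossing n j)\<^sup>2) \<le> K1 * V n"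
    using crossing_variance by blast
  obtain K2 where K2: "K2 > 0" "\<And>n J. n \<ge> 1 \<Longrightarrow> (\<Sum>j<J. (if real j < W n then 2 else 0 :: real)\<^sup>2) \<le> K2 * V n"
    using quadratic_variance by blast
  define F where "F r j a = (if even r then H * inv_pow 1 else (\<Sum>i<j. dev i (a i)) * inv_pow 1)"
    for r j :: nat and a :: "nat \<Rightarrow> nat"
  define Z where "Z r j a = (dev j (a j) * F r j a) $ (r div 2)" for r j :: nat and a :: "nat \<Rightarrow> nat"
  define b where "b r j = (if even r then crossing (r div 2) j else if real j < W (r div 2) then 2 else 0)" for r j :: nat
  \<comment> \<open>\<open>V 0 = 0\<close>, but a positive bound is asked for. At 0 all increments
    vanish and 1 will do.\<close>
  define v where "v r = (if r div 2 = 0 then 1 else (K1 + K2) * V (r div 2))" for r :: nat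
  have V_pos: "V n > 0" if "n \<ge> 1" for n
    using V_ge_1[OF that] by linarith
  have "\<exists>a. (\<forall>i. a i \<in> slice i) \<and> (\<forall>r J. \<bar>\<Sum>j<J. Z r j a\<bar> \<le> 4 * sqrt (v r * ln (real r + 2)))"
  proof (rule adaptive_choice[of slice p Z b v])
    show "finite (slice j)" "(\<Sum>y\<in>slice j. p j y) = 1" for j
      by (rule finite_slice, rule sum_p_slice)
    show "p j y \<ge> 0" for j y
      by (rule p_nonneg)
    show "Z r j a = Z r j a'" if "\<And>i. i \<le> j \<Longrightarrow> a i = a' i" for r j a a'
      using that by (simp add: Z_def F_def)
    show "(\<Sum>y\<in>slice j. p j y * Z r j (a(j := y))) = 0" for r j a
    proof -
      have "Z r j (a(j := y)) = (dev j y * F r j a) $ (r div 2)" for y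
        by (simp add: Z_def F_def)
      then show ?thesis
        by (simp add: mean_dev)
    qed
    show "\<bar>Z r j a\<bar> \<le> b r j" if "\<And>i. i \<le> j \<Longrightarrow> a i \<in> slice i" for r j a
      using that abs_linear_increment_le[of "a j" j "r div 2"] abs_quadratic_increment_le[of j a "r div 2"]
      by (simp add: Z_def F_def b_def)
    show "(\<Sum>j<J. (b r j)\<^sup>2) \<le> v r" for r J
    proof (cases "r div 2 = 0")
      case True
      then have "b r j = 0" for j
        by (simp add: b_def crossing_eq_0 W_0)
      then show ?thesis
        using True by (simp add: v_def)
    next
      case False
      then have "r div 2 \<ge> 1"
        by linarith
      then have le: "K1 * V (r div 2) \<le> v r" "K2 * V (r div 2) \<le> v r"
        using K1(1) K2(1) V_pos[of "r div 2"] False by (auto simp: v_def intro!: mult_right_mono)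
      show ?thesis
      proof (cases "even r")
        case True
        then have "(\<Sum>j<J. (b r j)\<^sup>2) = (\<Sum>j<J. (crossing (r div 2) j)\<^sup>2)"
          by (simp add: b_def)
        then show ?thesis
          using K1(2)[OF \<open>r div 2 \<ge> 1\<close>, of J] le by linarith
      next
        case False
        then have "(\<Sum>j<J. (b r j)\<^sup>2) = (\<Sum>j<J. (if real j < W (r div 2) then 2 else 0 :: real)\<^sup>2)"
          by (simp add: b_def)
        then show ?thesis
          using K2(2)[OF \<open>r div 2 \<ge> 1\<close>, of J] le by linarith
      qed
    qed
    show "v r > 0" for r
      using K1(1) K2(1) V_pos[of "r div 2"] by (auto simp: v_def not_less)
  qed
  then obtain a where a: "\<And>i. a i \<in> slice i" "\<And>r J. \<bar>\<Sum>j<J. Z r j a\<bar> \<le> 4 * sqrt (v r * ln (real r + 2))"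
    by blast
  define K where "K = 4 * sqrt (2 * (K1 + K2))"
  have bound: "\<bar>\<Sum>j<J. Z r j a\<bar> \<le> K * sqrt (V n * ln (real n + 2))" if n: "n \<ge> 1" "r div 2 = n" for n r J
  proof -
    have "r \<le> 2 * n + 1"
      using n by linarith
    then have "real r + 2 \<le> 2 * real n + 3"
      by linarith
    also have "\<dots> \<le> (real n + 2)\<^sup>2"
      by (simp add: power2_eq_square algebra_simps)
    finally have "ln (real r + 2) \<le> ln ((real n + 2)\<^sup>2)"
      by (intro ln_mono) auto
    also have "\<dots> = 2 * ln (real n + 2)"
      by (simp add: ln_realpow)
    finally have "v r * ln (real r + 2) \<le> (K1 + K2) * V n * (2 * ln (real n + 2))"
      using n K1(1) K2(1) V_pos[OF n(1)] by (auto simp: v_def intro!: mult_left_mono)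
    also have "\<dots> = (2 * (K1 + K2)) * (V n * ln (real n + 2))"
      by (simp only: mult_ac)
    finally have "4 * sqrt (v r * ln (real r + 2)) \<le> 4 * sqrt ((2 * (K1 + K2)) * (V n * ln (real n + 2)))"
      by (intro mult_left_mono real_sqrt_le_mono) auto
    also have "\<dots> = K * sqrt (V n * ln (real n + 2))"
      unfolding K_def real_sqrt_mult by (simp only: mult.assoc)
    finally show ?thesis
      using a(2)[of r J] by linarith
  qed
  have "\<bar>\<Sum>j<J. (dev j (a j) * (H * inv_pow 1)) $ n\<bar> \<le> K * sqrt (V n * ln (real n + 2))" if "n \<ge> 1" for n J
    using bound[of n "2 * n" J] that by (simp add: Z_def F_def)
  moreover have "\<bar>\<Sum>j<J. (dev j (a j) * ((\<Sum>i<j. dev i (a i)) * inv_pow 1)) $ n\<bar> \<le> K * sqrt (V n * ln (real n + 2))"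
    if "n \<ge> 1" for n J
    using bound[of n "2 * n + 1" J] that by (simp add: Z_def F_def)
  moreover have "K > 0"
    using K1(1) K2(1) by (simp add: K_def)
  ultimately show ?thesis
    using a(1) by blast
qed

lemma sum_M: "W x \<le> real J \<Longrightarrow> (\<Sum>i<J. M i x) = W x"
proof -
  have "(\<Sum>i<J. M i x) = min (W x) (real J)" for J
    using W_nonneg[of x] by (induction J) (auto simp: M_def min_def max_def)
  then show "W x \<le> real J \<Longrightarrow> (\<Sum>i<J. M i x) = W x"
    by simp
qed

text \<open>Only slices that begin below \<open>W n\<close> reach degree \<open>n\<close>, so a
  finite partial sum replaces the formal sum of all deviations and no convergence has to be
  discussed.\<close>

lemma value_series_deviation:
  assumes "\<And>i. a i \<in> slice i" "m \<le> n" "W n \<le> real J"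
  shows "(value_series a - H) $ m = (\<Sum>i<J. dev i (a i)) $ m"
proof -
  have "W m \<le> W n" "W (m - 1) \<le> W m"
    using assms(2) by (simp_all add: W_mono)
  then have "W m \<le> real J" "W (m - 1) \<le> real J"
    using assms(3) by linarith+
  then have "(\<Sum>i<J. p i m) = W m - W (m - 1)"
    by (simp add: p_def sum_subtractf sum_M)
  also have "\<dots> = h m"
    using W_Suc[of "m - 1"] by (cases m) (simp_all add: h_0)
  finally have "(\<Sum>i<J. p i m) = h m" .
  moreover have "{i. a i = m} = {i \<in> {..<J}. m = a i}"
  proof -
    have "i < J" if "a i = m" for i
      using assms(1)[of i] \<open>W m \<le> real J\<close> that by (auto simp: slice_def)
    then show ?thesis
      by auto
  qed
  then have "real (card {i. a i = m}) = (\<Sum>i<J. if m = a i then 1 else 0)"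
    by (simp add: sum.inter_filter[symmetric])
  ultimately show ?thesis
    by (simp add: value_series_def H_def dev_def fps_sum_nth sum_subtractf)
qed

lemma sqrt_V_ln_ge_1: "n \<ge> 1 \<Longrightarrow> 1 \<le> sqrt (V n * ln (real n + 2))"
proof -
  assume n: "n \<ge> 1"
  have "exp 1 \<le> real n + 2"
    using exp_le n by linarith
  then have "1 \<le> ln (real n + 2)"
    by (simp add: ln_ge_iff)
  then have "1 * 1 \<le> V n * ln (real n + 2)"
    using V_ge_1[OF n] by (intro mult_mono) auto
  then show ?thesis
    by simp
qed

text \<open>The square of the deviation series is twice the sum of the increments of a martingale plus the diagonal.\<close>

theorem slice_sequence:
  "\<exists>a K. (\<forall>i. a i \<in> slice i) \<and> K > 0 \<and> (\<forall>n\<ge>1.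
    \<bar>((value_series a - H) * H * inv_pow 1) $ n\<bar> \<le> K * sqrt (V n * ln (real n + 2)) \<and>
    \<bar>((value_series a - H) * (value_series a - H) * inv_pow 1) $ n\<bar> \<le> K * sqrt (V n * ln (real n + 2)))"
proof -
  obtain a K where a: "\<And>i. a i \<in> slice i" and K: "K > 0"
    and linear: "\<And>n J. n \<ge> 1 \<Longrightarrow> \<bar>\<Sum>j<J. (dev j (a j) * (H * inv_pow 1)) $ n\<bar> \<le> K * sqrt (V n * ln (real n + 2))"
    and quadratic: "\<And>n J. n \<ge> 1 \<Longrightarrow> \<bar>\<Sum>j<J. (dev j (a j) * ((\<Sum>i<j. dev i (a i)) * inv_pow 1)) $ n\<bar>
      \<le> K * sqrt (V n * ln (real n + 2))"
    using adapted_choice by blast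
  define D where "D = value_series a - H"
  have "\<bar>(D * H * inv_pow 1) $ n\<bar> \<le> (2 * K + 2) * sqrt (V n * ln (real n + 2))"
    "\<bar>(D * D * inv_pow 1) $ n\<bar> \<le> (2 * K + 2) * sqrt (V n * ln (real n + 2))" if n: "n \<ge> 1" for n
  proof -
    define B where "B = sqrt (V n * ln (real n + 2))"
    have B: "B \<ge> 1"
      unfolding B_def by (rule sqrt_V_ln_ge_1[OF n])
    define J where "J = nat \<lceil>W n\<rceil>"
    define E where "E j = (\<Sum>i<j. dev i (a i))" for j
    have "W n \<le> real J"
      unfolding J_def by (rule real_nat_ceiling_ge)
    then have DE: "D $ m = E J $ m" if "m \<le> n" for m
      unfolding D_def E_def by (rule value_series_deviation[OF a that])
    have "(D * H * inv_pow 1) $ n = (E J * (H * inv_pow 1)) $ n"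
      unfolding mult.assoc by (rule fps_mult_nth_cong_left[OF DE])
    also have "\<dots> = (\<Sum>j<J. (dev j (a j) * (H * inv_pow 1)) $ n)"
      by (simp add: E_def sum_distrib_right fps_sum_nth)
    finally have "\<bar>(D * H * inv_pow 1) $ n\<bar> \<le> K * B"
      unfolding B_def using linear[OF n] by simp
    also have "\<dots> \<le> (2 * K + 2) * B"
      using K B by (intro mult_right_mono) auto
    finally show "\<bar>(D * H * inv_pow 1) $ n\<bar> \<le> (2 * K + 2) * sqrt (V n * ln (real n + 2))"
      by (simp add: B_def)
    have "(D * D * inv_pow 1) $ n = (E J * (D * inv_pow 1)) $ n"
      unfolding mult.assoc by (rule fps_mult_nth_cong_left[OF DE])
    \<comment> \<open>The truncation applies to the left factor; commuting brings the second copy of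
      \<open>D\<close> there.\<close>
    also have "\<dots> = (D * (E J * inv_pow 1)) $ n"
      by (simp add: mult_ac)
    also have "\<dots> = (E J * (E J * inv_pow 1)) $ n"
      by (rule fps_mult_nth_cong_left[OF DE])
    also have "E j * (E j * inv_pow 1) = (\<Sum>i<j. 2 * (dev i (a i) * (E i * inv_pow 1))
        + dev i (a i) * (dev i (a i) * inv_pow 1))" for j
      by (induction j) (simp_all add: E_def algebra_simps)
    then have "(E J * (E J * inv_pow 1)) $ n = 2 * (\<Sum>i<J. (dev i (a i) * (E i * inv_pow 1)) $ n)
        + (\<Sum>i<J. (dev i (a i) * (dev i (a i) * inv_pow 1)) $ n)"
      by (simp add: fps_sum_nth sum.distrib fps_numeral_nth sum_distrib_left numeral_fps_const)
    finally have "\<bar>(D * D * inv_pow 1) $ n\<bar> \<le> 2 * (K * B) + 2"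
      using quadratic[OF n, of J] abs_diagonal_le[OF a, of n J] unfolding E_def B_def by linarith
    also have "\<dots> \<le> (2 * K + 2) * B"
      using B by (simp add: algebra_simps)
    finally show "\<bar>(D * D * inv_pow 1) $ n\<bar> \<le> (2 * K + 2) * sqrt (V n * ln (real n + 2))"
      by (simp add: B_def)
  qed
  then show ?thesis
    using a K unfolding D_def by (intro exI[of _ a] exI[of _ "2 * K + 2"]) auto
qed

section \<open>Order, positivity and counting function of the chosen sequence\<close>

lemma slice_pos: "y \<in> slice i \<Longrightarrow> y > 0"
  by (rule Nat.gr0I) (simp add: slice_def W_0)

lemma slice_mono:
  assumes "y \<in> slice i" "y' \<in> slice (Suc i)"
  shows "y \<le> y'"
proof -
  have "W (y - 1) < W y'"
    using assms by (simp add: slice_def)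
  then have "y - 1 < y'"
    by (rule W_less_imp)
  then show ?thesis
    by linarith
qed

lemma finite_fibre:
  assumes "\<And>i. a i \<in> slice i"
  shows "finite {i. a i \<le> m}"
proof (rule finite_subset)
  show "{i. a i \<le> m} \<subseteq> {..nat \<lceil>W m\<rceil>}"
  proof
    fix i assume "i \<in> {i. a i \<le> m}"
    then have "real i < W m"
      using assms[of i] W_mono[of "a i" m] by (simp add: slice_def)
    then show "i \<in> {..nat \<lceil>W m\<rceil>}"
      by (simp add: nat_le_iff[symmetric]) linarith
  qed
qed simp

lemma cum_value_series_le:
  assumes "\<And>i. a i \<in> slice i"
  shows "(value_series a * inv_pow 1) $ n \<le> W n + 1"
proof -
  define J where "J = nat \<lceil>W n\<rceil>"
  have "W n \<le> real J"
    unfolding J_def by (rule real_nat_ceiling_ge)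
  then have "((value_series a - H) * inv_pow 1) $ n = ((\<Sum>i<J. dev i (a i)) * inv_pow 1) $ n"
    by (intro fps_mult_nth_cong_left value_series_deviation assms)
  then have "((value_series a - H) * inv_pow 1) $ n \<le> 1"
    using abs_partial_cum_dev_le[of J a n] assms by (simp add: abs_le_iff)
  moreover have "(H * inv_pow 1) $ n = W n"
    by (simp add: inv_pow_mult_1_nth H_def W_def)
  ultimately show ?thesis
    by (simp add: left_diff_distrib)
qed

end

section \<open>Representations\<close>

text \<open>Separates the factor that carries the cancellation, \<open>U\<close>, from the remaining
  factors, for which nonnegativity and the size of the summatory function suffice.\<close>

lemma abs_mult_nth_le_cum:
  fixes P U :: "real fps"
  assumes "\<And>m. P $ m \<ge> 0" "\<And>m. m \<le> n \<Longrightarrow> \<bar>U $ m\<bar> \<le> T"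
  shows "\<bar>(P * U) $ n\<bar> \<le> (P * inv_pow 1) $ n * T"
proof -
  have "\<bar>(P * U) $ n\<bar> \<le> (\<Sum>i=0..n. \<bar>P $ i * U $ (n - i)\<bar>)"
    unfolding fps_mult_nth by (rule sum_abs)
  also have "\<dots> \<le> (\<Sum>i=0..n. P $ i * T)"
    using assms by (intro sum_mono) (auto simp: abs_mult intro!: mult_left_mono)
  also have "\<dots> = (P * inv_pow 1) $ n * T"
    by (simp add: inv_pow_mult_1_nth atLeast0AtMost sum_distrib_right)
  finally show ?thesis .
qed

lemma fps_mult_nth_nonneg:
  fixes P Q :: "real fps"
  assumes "\<And>m. P $ m \<ge> 0" "\<And>m. Q $ m \<ge> 0"
  shows "(P * Q) $ n \<ge> 0"
  unfolding fps_mult_nth by (intro sum_nonneg mult_nonneg_nonneg assms)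

lemma fps_power_nth_nonneg:
  fixes P :: "real fps"
  assumes "\<And>m. P $ m \<ge> 0"
  shows "(P ^ i) $ n \<ge> 0"
  by (induction i arbitrary: n) (auto intro!: fps_mult_nth_nonneg assms)

lemma cum_nonneg:
  assumes "\<And>m. P $ m \<ge> 0"
  shows "(P * inv_pow 1) $ n \<ge> 0"
  unfolding inv_pow_mult_1_nth by (intro sum_nonneg assms)

lemma cum_mult_le:
  assumes P: "\<And>m. P $ m \<ge> 0" and Q: "\<And>m. Q $ m \<ge> 0"
  shows "(P * Q * inv_pow 1) $ n \<le> (P * inv_pow 1) $ n * (Q * inv_pow 1) $ n"
proof -
  have "\<bar>(Q * inv_pow 1) $ m\<bar> \<le> (Q * inv_pow 1) $ n" if "m \<le> n" for m
  proof -
    have "(Q * inv_pow 1) $ m \<le> (Q * inv_pow 1) $ n"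
      unfolding inv_pow_mult_1_nth using that Q by (intro sum_mono2) auto
    then show ?thesis
      using cum_nonneg[OF Q] by simp
  qed
  then have "\<bar>(P * (Q * inv_pow 1)) $ n\<bar> \<le> (P * inv_pow 1) $ n * (Q * inv_pow 1) $ n"
    by (rule abs_mult_nth_le_cum[OF P])
  then show ?thesis
    by (simp add: mult.assoc)
qed

lemma cum_power_le:
  assumes P: "\<And>m. P $ m \<ge> 0"
  shows "(P ^ i * inv_pow 1) $ n \<le> ((P * inv_pow 1) $ n) ^ i"
proof (induction i)
  case (Suc i)
  have "(P ^ Suc i * inv_pow 1) $ n \<le> (P * inv_pow 1) $ n * (P ^ i * inv_pow 1) $ n"
    unfolding power_Suc by (intro cum_mult_le fps_power_nth_nonneg P)
  also have "\<dots> \<le> (P * inv_pow 1) $ n * ((P * inv_pow 1) $ n) ^ i"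
    by (intro mult_left_mono Suc cum_nonneg P)
  finally show ?case
    by simp
qed (simp add: inv_pow_1_nth)

text \<open>Induction on the tuple length: the first index is split off and grouped by its value.
  Finiteness is carried along because the cardinality of the dependent product needs it.\<close>

lemma rep_count_value_series:
  fixes a :: "nat \<Rightarrow> nat"
  assumes "\<And>m. finite {i. a i \<le> m}"
  shows "real (rep_count k (\<lambda>i. int (a i)) (int m)) = (value_series a ^ k) $ m"
proof -
  define R where "R k m = {xs. length xs = k \<and> (\<Sum>i\<leftarrow>xs. int (a i)) = int m}" for k m
  have "finite (R k m) \<and> real (card (R k m)) = (value_series a ^ k) $ m" for k m
  proof (induction k arbitrary: m)
    case 0
    have "R 0 m = (if m = 0 then {[]} else {})"
      by (auto simp: R_def)
    then show ?case
      by simp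
  next
    case (Suc k)
    have R_Suc: "R (Suc k) m = (\<lambda>(i, xs). i # xs) ` (SIGMA i:{i. a i \<le> m}. R k (m - a i))"
    proof (intro equalityI subsetI)
      fix js assume js: "js \<in> R (Suc k) m"
      then obtain i xs where split: "js = i # xs" "length xs = k"
        by (auto simp: R_def length_Suc_conv)
      then have sum: "int (a i) + (\<Sum>i\<leftarrow>xs. int (a i)) = int m"
        using js by (simp add: R_def)
      have "(\<Sum>i\<leftarrow>xs. int (a i)) \<ge> 0"
        by (intro sum_list_nonneg) auto
      then have "a i \<le> m" "xs \<in> R k (m - a i)"
        using sum split by (auto simp: R_def of_nat_diff)
      then show "js \<in> (\<lambda>(i, xs). i # xs) ` (SIGMA i:{i. a i \<le> m}. R k (m - a i))"
        using split by force
    next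
      fix js assume "js \<in> (\<lambda>(i, xs). i # xs) ` (SIGMA i:{i. a i \<le> m}. R k (m - a i))"
      then show "js \<in> R (Suc k) m"
        by (auto simp: R_def of_nat_diff)
    qed
    have inj: "inj_on (\<lambda>(i, xs). i # xs) X" for X :: "(nat \<times> nat list) set"
      by (auto simp: inj_on_def)
    have "finite (R (Suc k) m)"
      unfolding R_Suc using Suc assms by (intro finite_imageI finite_SigmaI) auto
    have "real (card (R (Suc k) m)) = (\<Sum>i\<in>{i. a i \<le> m}. (value_series a ^ k) $ (m - a i))"
      unfolding R_Suc card_image[OF inj] using Suc assms by (simp add: card_SigmaI)
    also have "\<dots> = (\<Sum>j=0..m. \<Sum>i\<in>{i \<in> {i. a i \<le> m}. a i = j}. (value_series a ^ k) $ (m - a i))"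
      using assms by (intro sum.group[symmetric]) auto
    also have "\<dots> = (\<Sum>j=0..m. real (card {i. a i = j}) * (value_series a ^ k) $ (m - j))"
    proof (rule sum.cong)
      fix j assume "j \<in> {0..m}"
      then have "{i \<in> {i. a i \<le> m}. a i = j} = {i. a i = j}"
        by auto
      then show "(\<Sum>i\<in>{i \<in> {i. a i \<le> m}. a i = j}. (value_series a ^ k) $ (m - a i)) =
          real (card {i. a i = j}) * (value_series a ^ k) $ (m - j)"
        by simp
    qed simp
    also have "\<dots> = (value_series a ^ Suc k) $ m"
      by (simp add: fps_mult_nth value_series_def)
    finally show ?case
      using \<open>finite (R (Suc k) m)\<close> by simp
  qed
  then show ?thesis
    by (simp add: rep_count_def R_def)
qed

lemma sum_inverse_le: "n \<ge> 1 \<Longrightarrow> (\<Sum>t=1..n. 1 / real t) \<le> 1 + ln (real n)"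
proof (induction n rule: nat_induct_at_least)
  case (Suc n)
  have "ln (real n / real (Suc n)) \<le> real n / real (Suc n) - 1"
    using Suc.hyps by (intro ln_le_minus_one) simp
  also have "\<dots> = - (1 / real (Suc n))"
    by (simp add: field_simps)
  finally have "1 / real (Suc n) \<le> ln (real (Suc n)) - ln (real n)"
    using Suc.hyps by (simp add: ln_div)
  then show ?case
    using Suc.IH by simp
qed simp

section \<open>From the \<open>k\<close>-th power to the linear and quadratic deviations\<close>

context weights
begin

text \<open>After factoring \<open>D\<close> out of \<open>S ^ k - H ^ k\<close>,
  \<open>k \<ge> 2\<close> leaves in each summand a factor \<open>H\<close> or \<open>S\<close> to
  be paired with \<open>D\<close>; the other \<open>k - 2\<close> factors cost \<open>X\<close>
  each. The factor 2 stems from \<open>D * S = D * D + D * H\<close>.\<close>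

lemma power_deviation_le:
  assumes a: "\<And>i. a i \<in> slice i" and k: "k \<ge> 2" and n: "n \<ge> 1"
    and linear: "\<And>m. 1 \<le> m \<Longrightarrow> m \<le> n \<Longrightarrow> \<bar>((value_series a - H) * H * inv_pow 1) $ m\<bar> \<le> T"
    and quadratic: "\<And>m. 1 \<le> m \<Longrightarrow> m \<le> n \<Longrightarrow>
      \<bar>((value_series a - H) * (value_series a - H) * inv_pow 1) $ m\<bar> \<le> T"
  shows "\<bar>((value_series a ^ k - H ^ k) * inv_pow 1) $ n\<bar>
    \<le> real k * (((C / \<alpha> + 1) * real n powr \<alpha>) ^ (k - 2) * (2 * T))"
proof -
  define S where "S = value_series a"
  define D where "D = S - H"
  define X where "X = (C / \<alpha> + 1) * real n powr \<alpha>"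
  have "real n powr \<alpha> \<ge> 1"
    using n \<alpha> by (simp add: ge_one_powr_ge_zero)
  then have WX: "W n + 1 \<le> X"
    using W_upper[of n] by (simp add: X_def distrib_right)
  have T: "T \<ge> 0"
    using linear[of 1] n by linarith
  have S0: "S $ m \<ge> 0" and H0: "H $ m \<ge> 0" for m
    by (simp_all add: S_def value_series_def H_def h_nonneg)
  have cumS: "(S * inv_pow 1) $ n \<le> X"
    using cum_value_series_le[OF a, of n] WX by (simp add: S_def)
  have cumH: "(H * inv_pow 1) $ n \<le> X"
    using WX by (simp add: inv_pow_mult_1_nth H_def flip: W_def)
  have X0: "X \<ge> 0"
    using cumH cum_nonneg[OF H0, of n] by linarith
  have cum_prod: "(H ^ i * S ^ j * inv_pow 1) $ n \<le> X ^ (i + j)" for i j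
  proof -
    have "(H ^ i * S ^ j * inv_pow 1) $ n \<le> (H ^ i * inv_pow 1) $ n * (S ^ j * inv_pow 1) $ n"
      by (intro cum_mult_le fps_power_nth_nonneg S0 H0)
    also have "\<dots> \<le> ((H * inv_pow 1) $ n) ^ i * ((S * inv_pow 1) $ n) ^ j"
      by (intro mult_mono cum_power_le zero_le_power cum_nonneg fps_power_nth_nonneg S0 H0)
    also have "\<dots> \<le> X ^ i * X ^ j"
      using X0 by (intro mult_mono power_mono cumS cumH zero_le_power cum_nonneg S0 H0)
    finally show ?thesis
      by (simp add: power_add)
  qed
  \<comment> \<open>The hypotheses start at \<open>m = 1\<close>, so the coefficient at 0 is treated
    separately.\<close>
  have D0: "D $ 0 = 0"
  proof -
    have "{i. a i = 0} = {}"
      using slice_pos[OF a] by auto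
    then have "card {i. a i = 0} = 0"
      by (simp only: card.empty)
    then show ?thesis
      by (simp add: D_def S_def H_def value_series_def h_0)
  qed
  have DH: "\<bar>(D * H * inv_pow 1) $ m\<bar> \<le> T" if "m \<le> n" for m
    using linear[of m] that T D0 by (cases "m = 0") (auto simp: D_def S_def)
  have DD: "\<bar>(D * D * inv_pow 1) $ m\<bar> \<le> T" if "m \<le> n" for m
    using quadratic[of m] that T D0 by (cases "m = 0") (auto simp: D_def S_def)
  have DS: "\<bar>(D * S * inv_pow 1) $ m\<bar> \<le> 2 * T" if "m \<le> n" for m
  proof -
    have "D * S * inv_pow 1 = D * D * inv_pow 1 + D * H * inv_pow 1"
      by (simp add: D_def algebra_simps)
    then show ?thesis
      using DH[OF that] DD[OF that] by simp
  qed
  have summand: "\<bar>(D * (H ^ (k - Suc i) * S ^ i) * inv_pow 1) $ n\<bar> \<le> X ^ (k - 2) * (2 * T)" if i: "i < k" for i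
  proof (cases "Suc i = k")
    \<comment> \<open>Only the summand with \<open>i = k - 1\<close> lacks a factor
      \<open>H\<close>; here \<open>D\<close> is paired with an \<open>S\<close>.\<close>
    case True
    have "i = Suc (k - 2)"
      using True k by linarith
    then have "S ^ i = S ^ (k - 2) * S"
      by (simp only: power_Suc2)
    then have "D * (H ^ (k - Suc i) * S ^ i) * inv_pow 1 = (H ^ 0 * S ^ (k - 2)) * (D * S * inv_pow 1)"
      using True by (simp add: mult_ac)
    also have "\<bar>(\<dots>) $ n\<bar> \<le> (H ^ 0 * S ^ (k - 2) * inv_pow 1) $ n * (2 * T)"
      by (intro abs_mult_nth_le_cum DS fps_mult_nth_nonneg fps_power_nth_nonneg S0 H0)
    also have "\<dots> \<le> X ^ (k - 2) * (2 * T)"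
      using cum_prod[of 0 "k - 2"] T by (intro mult_right_mono) auto
    finally show ?thesis .
  next
    case False
    then have i2: "k - Suc i = Suc (k - 2 - i)" "k - 2 - i + i = k - 2"
      using i k by auto
    have "D * (H ^ (k - Suc i) * S ^ i) * inv_pow 1 = (H ^ (k - 2 - i) * S ^ i) * (D * H * inv_pow 1)"
      unfolding i2 by (simp add: mult_ac)
    also have "\<bar>(\<dots>) $ n\<bar> \<le> (H ^ (k - 2 - i) * S ^ i * inv_pow 1) $ n * (2 * T)"
    proof (rule abs_mult_nth_le_cum)
      show "\<bar>(D * H * inv_pow 1) $ m\<bar> \<le> 2 * T" if "m \<le> n" for m
        using DH[OF that] T by linarith
    qed (intro fps_mult_nth_nonneg fps_power_nth_nonneg S0 H0)
    also have "\<dots> \<le> X ^ (k - 2) * (2 * T)"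
      using cum_prod[of "k - 2 - i" i] T i2 by (intro mult_right_mono) auto
    finally show ?thesis .
  qed
  have "S ^ k - H ^ k = D * (\<Sum>i<k. H ^ (k - Suc i) * S ^ i)"
    unfolding D_def by (rule power_diff_sumr2)
  then have "((S ^ k - H ^ k) * inv_pow 1) $ n = (\<Sum>i<k. (D * (H ^ (k - Suc i) * S ^ i) * inv_pow 1) $ n)"
    by (simp add: sum_distrib_left sum_distrib_right fps_sum_nth)
  also have "\<bar>\<dots>\<bar> \<le> (\<Sum>i<k. \<bar>(D * (H ^ (k - Suc i) * S ^ i) * inv_pow 1) $ n\<bar>)"
    by (rule sum_abs)
  also have "\<dots> \<le> (\<Sum>i<k. X ^ (k - 2) * (2 * T))"
    by (intro sum_mono summand) auto
  finally show ?thesis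
    by (simp add: S_def X_def)
qed

text \<open>The sequence is fixed before \<open>e\<close>, \<open>g\<close> and \<open>B\<close>, so
  that each regime can supply its own bound on the variance later. Monotonicity of
  \<open>n powr e * g n\<close> turns the bounds at all \<open>m \<le> n\<close> into a single one
  at \<open>n\<close>.\<close>

lemma slice_sequence_power:
  "\<exists>a. (\<forall>i. a i \<in> slice i) \<and> (\<forall>k e g B. k \<ge> 2 \<longrightarrow> e \<ge> 0 \<longrightarrow> mono g \<longrightarrow> (\<forall>n\<ge>1. 0 \<le> g n) \<longrightarrow>
    (\<forall>n\<ge>1. sqrt (V n * ln (real n + 2)) \<le> B * (real n powr e * g n)) \<longrightarrow>
    (\<lambda>n. ((value_series a ^ k - H ^ k) * inv_pow 1) $ n) \<in> O(\<lambda>n. real n powr (real k * \<alpha> - 2 * \<alpha> + e) * g n))"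
proof -
  obtain a K where a: "\<And>i. a i \<in> slice i" and K: "K > 0"
    and linear: "\<And>n. n \<ge> 1 \<Longrightarrow> \<bar>((value_series a - H) * H * inv_pow 1) $ n\<bar> \<le> K * sqrt (V n * ln (real n + 2))"
    and quadratic: "\<And>n. n \<ge> 1 \<Longrightarrow>
      \<bar>((value_series a - H) * (value_series a - H) * inv_pow 1) $ n\<bar> \<le> K * sqrt (V n * ln (real n + 2))"
    using slice_sequence by blast
  have "(\<lambda>n. ((value_series a ^ k - H ^ k) * inv_pow 1) $ n) \<in> O(\<lambda>n. real n powr (real k * \<alpha> - 2 * \<alpha> + e) * g n)"
    if k: "k \<ge> 2" and e: "e \<ge> 0" and g: "mono g" "\<forall>n\<ge>1. 0 \<le> g n"
      and B: "\<forall>n\<ge>1. sqrt (V n * ln (real n + 2)) \<le> B * (real n powr e * g n)" for k e g B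
  proof (rule bigoI)
    define Y where "Y = real k * ((C / \<alpha> + 1) ^ (k - 2) * (2 * (K * \<bar>B\<bar>)))"
    show "eventually (\<lambda>n. norm (((value_series a ^ k - H ^ k) * inv_pow 1) $ n)
        \<le> Y * norm (real n powr (real k * \<alpha> - 2 * \<alpha> + e) * g n)) sequentially"
      using eventually_ge_at_top[of 1]
    proof eventually_elim
      case n: (elim n)
      define T where "T = K * \<bar>B\<bar> * (real n powr e * g n)"
      have T: "K * sqrt (V m * ln (real m + 2)) \<le> T" if m: "1 \<le> m" "m \<le> n" for m
      proof -
        have "sqrt (V m * ln (real m + 2)) \<le> B * (real m powr e * g m)"
          using B m by blast
        also have "\<dots> \<le> \<bar>B\<bar> * (real m powr e * g m)"
          using g m by (intro mult_right_mono) auto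
        also have "\<dots> \<le> \<bar>B\<bar> * (real n powr e * g n)"
          using g m e monoD[OF g(1), of m n] by (intro mult_left_mono mult_mono powr_mono2) auto
        finally have "K * sqrt (V m * ln (real m + 2)) \<le> K * (\<bar>B\<bar> * (real n powr e * g n))"
          using K by (intro mult_left_mono) auto
        then show ?thesis
          by (simp add: T_def mult.assoc)
      qed
      have "\<bar>((value_series a ^ k - H ^ k) * inv_pow 1) $ n\<bar>
          \<le> real k * (((C / \<alpha> + 1) * real n powr \<alpha>) ^ (k - 2) * (2 * T))"
        by (rule power_deviation_le[OF a k n order_trans[OF linear T] order_trans[OF quadratic T]])
      also have "((C / \<alpha> + 1) * real n powr \<alpha>) ^ (k - 2) =
          (C / \<alpha> + 1) ^ (k - 2) * real n powr (real k * \<alpha> - 2 * \<alpha>)"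
      proof -
        have "real (k - 2) * \<alpha> = real k * \<alpha> - 2 * \<alpha>"
          using k by (simp add: of_nat_diff algebra_simps)
        then have "(real n powr \<alpha>) ^ (k - 2) = real n powr (real k * \<alpha> - 2 * \<alpha>)"
          using n by (simp add: powr_power)
        then show ?thesis
          by (simp only: power_mult_distrib)
      qed
      also have "real k * ((C / \<alpha> + 1) ^ (k - 2) * real n powr (real k * \<alpha> - 2 * \<alpha>) * (2 * T)) =
          Y * (real n powr (real k * \<alpha> - 2 * \<alpha> + e) * g n)"
        by (simp add: Y_def T_def powr_add)
      also have "\<dots> = Y * norm (real n powr (real k * \<alpha> - 2 * \<alpha> + e) * g n)"
        using g n by simp
      finally show ?case
        by simp
    qed
  qed
  then show ?thesis
    using a by blast
qed

section \<open>The variance bound in the three regimes\<close>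

lemma Suc_floor_W_le: "n \<ge> 1 \<Longrightarrow> real (Suc (nat \<lfloor>W n\<rfloor>)) \<le> (C / \<alpha> + 1) * real n powr \<alpha>"
proof -
  assume "n \<ge> 1"
  then have "real n powr \<alpha> \<ge> 1"
    using \<alpha> by (simp add: ge_one_powr_ge_zero)
  moreover have "real (nat \<lfloor>W n\<rfloor>) \<le> W n"
    using W_nonneg[of n] by simp
  ultimately show ?thesis
    using W_upper[of n] by (simp add: distrib_right)
qed

lemma sqrt_powr_double: "sqrt (real n powr (2 * e)) = real n powr e"
  by (simp add: powr_half_sqrt[symmetric] powr_powr)

text \<open>The sum over \<open>t\<close> converges, and
  \<open>\<alpha> \<le> 2 * (\<alpha> * (1 - \<alpha>))\<close> makes the first summand of
  \<open>V\<close> decisive.\<close>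

lemma V_bound_small:
  assumes "\<alpha> < 1 / 2"
  shows "\<exists>B. \<forall>n\<ge>1. sqrt (V n * ln (real n + 2)) \<le> B * (real n powr (\<alpha> * (1 - \<alpha>)) * sqrt (ln (real n + 2)))"
proof -
  define B where "B = (\<Sum>t. real t powr (2 * \<alpha> - 2))"
  have "summable (\<lambda>t. real t powr (2 * \<alpha> - 2))"
    using assms by (subst summable_real_powr_iff) auto
  then have sum: "(\<Sum>t=1..N. real t powr (2 * \<alpha> - 2)) \<le> B" for N
    unfolding B_def by (rule sum_le_suminf) auto
  have "sqrt (V n * ln (real n + 2)) \<le> sqrt (B + 1) * (real n powr (\<alpha> * (1 - \<alpha>)) * sqrt (ln (real n + 2)))" if n: "n \<ge> 1" for n
  proof -
    have "\<alpha> \<le> 2 * (\<alpha> * (1 - \<alpha>))"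
      using mult_left_mono[of "1 / 2" "1 - \<alpha>" \<alpha>] assms \<alpha> by simp
    then have "V n \<le> real n powr (2 * (\<alpha> * (1 - \<alpha>))) * B + real n powr (2 * (\<alpha> * (1 - \<alpha>)))"
      unfolding V_def using n by (intro add_mono mult_left_mono powr_mono sum) auto
    then have "V n * ln (real n + 2) \<le> (B + 1) * (real n powr (2 * (\<alpha> * (1 - \<alpha>)))) * ln (real n + 2)"
      by (intro mult_right_mono) (auto simp: algebra_simps)
    then have "sqrt (V n * ln (real n + 2)) \<le> sqrt ((B + 1) * (real n powr (2 * (\<alpha> * (1 - \<alpha>)))) * ln (real n + 2))"
      by (rule real_sqrt_le_mono)
    then show ?thesis
      by (simp only: real_sqrt_mult sqrt_powr_double mult.assoc)
  qed
  then show ?thesis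
    by blast
qed

text \<open>The sum over \<open>t\<close> is now at most of order
  \<open>n powr (\<alpha> * (2 * \<alpha> - 1))\<close>; the exponents add up to
  \<open>\<alpha>\<close>, so both summands of \<open>V\<close> get the same bound.\<close>

lemma V_bound_large:
  assumes "\<alpha> > 1 / 2"
  shows "\<exists>B. \<forall>n\<ge>1. sqrt (V n * ln (real n + 2)) \<le> B * (real n powr (\<alpha> / 2) * sqrt (ln (real n + 2)))"
proof -
  define X where "X = C / \<alpha> + 1"
  define B where "B = X powr (2 * \<alpha> - 1) / (2 * \<alpha> - 1)"
  have X: "X > 0"
    using C_pos \<alpha> by (simp add: X_def add_pos_pos)
  have "sqrt (V n * ln (real n + 2)) \<le> sqrt (B + 1) * (real n powr (\<alpha> / 2) * sqrt (ln (real n + 2)))" if n: "n \<ge> 1" for n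
  proof -
    have "(\<Sum>t=1..Suc (nat \<lfloor>W n\<rfloor>). real t powr (2 * \<alpha> - 2)) \<le> real (Suc (nat \<lfloor>W n\<rfloor>)) powr (2 * \<alpha> - 1) / (2 * \<alpha> - 1)"
      using sum_powr_le[of "2 * \<alpha> - 1" "Suc (nat \<lfloor>W n\<rfloor>)"] assms \<alpha> by simp
    also have "\<dots> \<le> (X * real n powr \<alpha>) powr (2 * \<alpha> - 1) / (2 * \<alpha> - 1)"
      using Suc_floor_W_le[OF n] assms by (intro divide_right_mono powr_mono2) (auto simp: X_def)
    also have "\<dots> = B * real n powr (\<alpha> * (2 * \<alpha> - 1))"
      using X by (simp add: B_def powr_mult powr_powr)
    finally have "V n \<le> real n powr (2 * (\<alpha> * (1 - \<alpha>))) * (B * real n powr (\<alpha> * (2 * \<alpha> - 1))) + real n powr \<alpha>"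
      unfolding V_def by (intro add_right_mono mult_left_mono) auto
    also have "real n powr (2 * (\<alpha> * (1 - \<alpha>))) * (B * real n powr (\<alpha> * (2 * \<alpha> - 1))) = B * real n powr \<alpha>"
    proof -
      have "2 * (\<alpha> * (1 - \<alpha>)) + \<alpha> * (2 * \<alpha> - 1) = \<alpha>"
        by (simp add: algebra_simps)
      then have "real n powr (2 * (\<alpha> * (1 - \<alpha>))) * real n powr (\<alpha> * (2 * \<alpha> - 1)) = real n powr \<alpha>"
        by (simp only: flip: powr_add)
      then show ?thesis
        by (simp add: mult.left_commute)
    qed
    finally have "V n * ln (real n + 2) \<le> (B + 1) * (real n powr (2 * (\<alpha> / 2))) * ln (real n + 2)"
      by (intro mult_right_mono) (auto simp: algebra_simps)
    then have "sqrt (V n * ln (real n + 2)) \<le> sqrt ((B + 1) * (real n powr (2 * (\<alpha> / 2))) * ln (real n + 2))"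
      by (rule real_sqrt_le_mono)
    then show ?thesis
      by (simp only: real_sqrt_mult sqrt_powr_double mult.assoc)
  qed
  then show ?thesis
    by blast
qed

text \<open>The sum over \<open>t\<close> is harmonic; its logarithm, together with the one from the
  tail bound, comes out of the root as a full logarithm.\<close>

lemma V_bound_half:
  assumes "\<alpha> = 1 / 2"
  shows "\<exists>B. \<forall>n\<ge>1. sqrt (V n * ln (real n + 2)) \<le> B * (real n powr (1 / 4) * ln (real n + 2))"
proof -
  define X where "X = C / \<alpha> + 1"
  define B where "B = 3 + \<bar>ln X\<bar>"
  have X: "X > 0"
    using C_pos \<alpha> by (simp add: X_def add_pos_pos)
  have "sqrt (V n * ln (real n + 2)) \<le> sqrt B * (real n powr (1 / 4) * ln (real n + 2))" if n: "n \<ge> 1" for n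
  proof -
    define L where "L = ln (real n + 2)"
    have "exp 1 \<le> real n + 2"
      using exp_le n by linarith
    then have L: "L \<ge> 1"
      by (simp add: L_def ln_ge_iff)
    have "real n powr \<alpha> \<le> real n powr 1"
      using n \<alpha> by (intro powr_mono) auto
    then have "X * real n powr \<alpha> \<le> X * (real n + 2)"
      using X by (intro mult_left_mono) auto
    then have "real (Suc (nat \<lfloor>W n\<rfloor>)) \<le> X * (real n + 2)"
      using Suc_floor_W_le[OF n] unfolding X_def by linarith
    then have "ln (real (Suc (nat \<lfloor>W n\<rfloor>))) \<le> ln (X * (real n + 2))"
      by (intro ln_mono) auto
    also have "\<dots> = ln X + L"
      using X by (simp add: ln_mult_pos L_def)
    finally have ln_le: "1 + ln (real (Suc (nat \<lfloor>W n\<rfloor>))) \<le> 1 + \<bar>ln X\<bar> + L"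
      by linarith
    have "(\<Sum>t=1..Suc (nat \<lfloor>W n\<rfloor>). real t powr (2 * \<alpha> - 2)) = (\<Sum>t=1..Suc (nat \<lfloor>W n\<rfloor>). 1 / real t)"
    proof -
      have "2 * \<alpha> - 2 = - 1"
        using assms by simp
      then show ?thesis
        by (intro sum.cong refl) (simp only: powr_minus_divide, simp)
    qed
    also have "\<dots> \<le> 1 + \<bar>ln X\<bar> + L"
      using sum_inverse_le[of "Suc (nat \<lfloor>W n\<rfloor>)"] ln_le by linarith
    also have "\<dots> \<le> (2 + \<bar>ln X\<bar>) * L"
      using mult_left_mono[OF L, of "1 + \<bar>ln X\<bar>"] by (simp add: algebra_simps)
    finally have "real n powr (2 * (1 / 4)) * (\<Sum>t=1..Suc (nat \<lfloor>W n\<rfloor>). real t powr (2 * \<alpha> - 2)) + real n powr (2 * (1 / 4)) * 1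
        \<le> real n powr (2 * (1 / 4)) * ((2 + \<bar>ln X\<bar>) * L) + real n powr (2 * (1 / 4)) * 1"
      by (intro add_right_mono mult_left_mono) auto
    moreover have "2 * (\<alpha> * (1 - \<alpha>)) = 2 * (1 / 4)" "real n powr \<alpha> = real n powr (2 * (1 / 4)) * 1"
      by (simp_all add: assms)
    ultimately have "V n \<le> real n powr (2 * (1 / 4)) * ((2 + \<bar>ln X\<bar>) * L) + real n powr (2 * (1 / 4)) * 1"
      by (simp only: V_def)
    also have "\<dots> \<le> real n powr (2 * (1 / 4)) * ((2 + \<bar>ln X\<bar>) * L) + real n powr (2 * (1 / 4)) * L"
      using L by (intro add_left_mono mult_left_mono) auto
    also have "\<dots> = B * real n powr (2 * (1 / 4)) * L"
      by (simp add: B_def algebra_simps)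
    finally have "V n * L \<le> B * real n powr (2 * (1 / 4)) * L * L"
      using L by (intro mult_right_mono) auto
    then have "sqrt (V n * L) \<le> sqrt (B * real n powr (2 * (1 / 4)) * L * L)"
      by (rule real_sqrt_le_mono)
    also have "\<dots> = sqrt B * real n powr (1 / 4) * (sqrt L * sqrt L)"
      by (simp only: real_sqrt_mult sqrt_powr_double mult.assoc)
    also have "sqrt L * sqrt L = L"
      using L by simp
    finally show ?thesis
      by (simp add: L_def mult.assoc)
  qed
  then show ?thesis
    by blast
qed

end

theorem theorem1p1:
  fixes k :: nat and \<beta> :: real
  assumes "k \<ge> 2" and "0 < \<beta>" and "\<beta> < real k"
  shows "\<exists>(A :: nat \<Rightarrow> int) (C :: real).
    incseq A \<and> (\<forall>i. A i > 0) \<and> filterlim A at_top sequentially \<and> C > 0 \<and>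
    (let E = (\<lambda>n :: nat. (\<Sum>m = 1..n. real (rep_count k A (int m))) - C * real n powr \<beta>) in
      (real k > 2 * \<beta> \<longrightarrow>
        E \<in> O(\<lambda>n. real n powr (\<beta> - \<beta> * (real k + \<beta>) / (real k)\<^sup>2) * sqrt (ln (real n)))) \<and>
      (real k < 2 * \<beta> \<longrightarrow>
        E \<in> O(\<lambda>n. real n powr (\<beta> - 3 * \<beta> / (2 * real k)) * sqrt (ln (real n)))) \<and>
      (real k = 2 * \<beta> \<longrightarrow>
        E \<in> O(\<lambda>n. real n powr (\<beta> - 3 / 4) * ln (real n))))"
proof -
  define \<alpha> where "\<alpha> = \<beta> / real k"
  define q where "q = (\<beta> + 1) / (2 * real k)"
  have \<alpha>: "0 < \<alpha>" "\<alpha> < 1" and k\<alpha>: "real k * \<alpha> = \<beta>"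
    using assms by (simp_all add: \<alpha>_def)
  have q: "0 \<le> q" "q \<le> 1"
    using assms by (simp_all add: q_def)
  obtain c0 C0 where "c0 > 0" "\<forall>m\<ge>1. c0 * real m powr (\<alpha> - 1) \<le> weight_series \<alpha> q $ m \<and>
      weight_series \<alpha> q $ m \<le> C0 * real m powr (\<alpha> - 1)"
    using weight_series_bounds[OF \<alpha> q] by blast
  then interpret weights "fps_nth (weight_series \<alpha> q)" \<alpha> c0 C0
    using \<alpha> by unfold_locales (auto simp: weight_series_nth_0)
  have H: "H = weight_series \<alpha> q"
    by (simp add: H_def fps_nth_inverse)
  obtain a where a: "\<And>i. a i \<in> slice i"
    and dev_bigo: "\<And>e g B. e \<ge> 0 \<Longrightarrow> mono g \<Longrightarrow> \<forall>n\<ge>1. 0 \<le> g n \<Longrightarrow>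
      \<forall>n\<ge>1. sqrt (V n * ln (real n + 2)) \<le> B * (real n powr e * g n) \<Longrightarrow>
      (\<lambda>n. ((value_series a ^ k - H ^ k) * inv_pow 1) $ n) \<in> O(\<lambda>n. real n powr (\<beta> - 2 * \<alpha> + e) * g n)"
    using slice_sequence_power assms(1) unfolding k\<alpha>[symmetric] by blast
  obtain C where C: "C > 0" and main: "(\<lambda>n. (H ^ k * inv_pow 1) $ n - C * real n powr \<beta>) \<in> O(\<lambda>n. real n powr (\<beta> - \<alpha> - 1))"
    using weight_series_power_asymptotics[OF \<alpha>, of k] assms(1) unfolding k\<alpha> H unfolding q_def by auto
  define A where "A i = int (a i)" for i
  define E where "E n = (\<Sum>m=1..n. real (rep_count k A (int m))) - C * real n powr \<beta>" for n :: nat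
  have E: "E n = ((H ^ k * inv_pow 1) $ n - C * real n powr \<beta>) + ((value_series a ^ k - H ^ k) * inv_pow 1) $ n" for n
  proof -
    have "{i. a i = 0} = {}"
      using slice_pos[OF a] by auto
    then have "card {i. a i = 0} = 0"
      by (simp only: card.empty)
    then have "(value_series a ^ k) $ 0 = 0"
      using assms(1) by (simp add: fps_nth_power_0 value_series_def)
    then have "(\<Sum>m=1..n. (value_series a ^ k) $ m) = (\<Sum>m\<le>n. (value_series a ^ k) $ m)"
      by (simp add: sum.atMost_shift sum.atLeast1_atMost_eq lessThan_atLeast0 atLeastLessThanSuc_atLeastAtMost)
    then have "(\<Sum>m=1..n. real (rep_count k A (int m))) = (value_series a ^ k * inv_pow 1) $ n"
      unfolding A_def using finite_fibre[OF a] by (simp add: rep_count_value_series inv_pow_mult_1_nth)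
    then show ?thesis
      by (simp add: E_def left_diff_distrib)
  qed
  have bigo: "E \<in> O(\<lambda>n. real n powr (\<beta> - 2 * \<alpha> + e) * g n)"
    if e: "e \<ge> 0" and g: "mono g" "\<And>n. n \<ge> 1 \<Longrightarrow> 1 \<le> g n"
      and B: "\<exists>B. \<forall>n\<ge>1. sqrt (V n * ln (real n + 2)) \<le> B * (real n powr e * g n)" for e g
  proof -
    \<comment> \<open>The error of the main term is absorbed because \<open>\<alpha> < 1\<close>,
      \<open>e \<ge> 0\<close> and \<open>g n \<ge> 1\<close>.\<close>
    have "(\<lambda>n. real n powr (\<beta> - \<alpha> - 1)) \<in> O(\<lambda>n. real n powr (\<beta> - 2 * \<alpha> + e) * g n)"
    proof (rule bigoI[of _ 1])
      show "eventually (\<lambda>n. norm (real n powr (\<beta> - \<alpha> - 1)) \<le> 1 * norm (real n powr (\<beta> - 2 * \<alpha> + e) * g n)) sequentially"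
        using eventually_ge_at_top[of 1]
      proof eventually_elim
        case (elim n)
        have "real n powr (\<beta> - \<alpha> - 1) * 1 \<le> real n powr (\<beta> - 2 * \<alpha> + e) * g n"
          using elim e \<alpha> g(2)[OF elim] by (intro mult_mono powr_mono) auto
        then show ?case
          using g(2)[OF elim] by (simp add: abs_mult)
      qed
    qed
    then have "(\<lambda>n. (H ^ k * inv_pow 1) $ n - C * real n powr \<beta>) \<in> O(\<lambda>n. real n powr (\<beta> - 2 * \<alpha> + e) * g n)"
      by (rule landau_o.big_trans[OF main])
    moreover have "\<forall>n\<ge>1. 0 \<le> g n"
      using g(2) by (meson order_trans zero_le_one)
    then have "(\<lambda>n. ((value_series a ^ k - H ^ k) * inv_pow 1) $ n) \<in> O(\<lambda>n. real n powr (\<beta> - 2 * \<alpha> + e) * g n)"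
      using B dev_bigo[OF e g(1)] by blast
    ultimately show ?thesis
      unfolding E[abs_def] by (rule sum_in_bigo(1))
  qed
  \<comment> \<open>The shift by 2 keeps the logarithm at least 1 from \<open>n = 1\<close> on;
    \<open>to_ln\<close> removes it asymptotically.\<close>
  define l where "l n = ln (real n + 2)" for n :: nat
  have l_mono: "mono l"
    by (auto simp: l_def intro!: monoI ln_mono)
  have l_ge_1: "1 \<le> l n" if "n \<ge> 1" for n
  proof -
    have "exp 1 \<le> real n + 2"
      using exp_le that by linarith
    then show ?thesis
      by (simp add: l_def ln_ge_iff)
  qed
  have sqrt_l_mono: "mono (\<lambda>n. sqrt (l n))"
    using l_mono by (simp add: mono_def)
  have to_ln: "(\<lambda>n. sqrt (l n)) \<in> O(\<lambda>n. sqrt (ln (real n)))" "l \<in> O(\<lambda>n. ln (real n))"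
    unfolding l_def by real_asymp+
  have "E \<in> O(\<lambda>n. real n powr (\<beta> - \<beta> * (real k + \<beta>) / (real k)\<^sup>2) * sqrt (ln (real n)))" if "real k > 2 * \<beta>"
  proof -
    have "\<alpha> < 1 / 2"
      using that assms by (simp add: \<alpha>_def field_simps)
    then have "E \<in> O(\<lambda>n. real n powr (\<beta> - 2 * \<alpha> + \<alpha> * (1 - \<alpha>)) * sqrt (l n))"
      using V_bound_small \<alpha> l_ge_1 by (intro bigo sqrt_l_mono) (auto simp: l_def)
    \<comment> \<open>Both exponents equal
      \<open>\<beta> - \<alpha> * (1 + \<alpha>)\<close>.\<close>
    also have "\<beta> - 2 * \<alpha> + \<alpha> * (1 - \<alpha>) = \<beta> - \<beta> * (real k + \<beta>) / (real k)\<^sup>2"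
      using assms by (simp add: \<alpha>_def field_simps power2_eq_square)
    also have "(\<lambda>n. real n powr (\<beta> - \<beta> * (real k + \<beta>) / (real k)\<^sup>2) * sqrt (l n)) \<in>
        O(\<lambda>n. real n powr (\<beta> - \<beta> * (real k + \<beta>) / (real k)\<^sup>2) * sqrt (ln (real n)))"
      by (intro landau_o.big.mult_left to_ln)
    finally show ?thesis .
  qed
  moreover have "E \<in> O(\<lambda>n. real n powr (\<beta> - 3 * \<beta> / (2 * real k)) * sqrt (ln (real n)))" if "real k < 2 * \<beta>"
  proof -
    have "\<alpha> > 1 / 2"
      using that assms by (simp add: \<alpha>_def field_simps)
    then have "E \<in> O(\<lambda>n. real n powr (\<beta> - 2 * \<alpha> + \<alpha> / 2) * sqrt (l n))"
      using V_bound_large \<alpha> l_ge_1 by (intro bigo sqrt_l_mono) (auto simp: l_def)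
    also have "\<beta> - 2 * \<alpha> + \<alpha> / 2 = \<beta> - 3 * \<beta> / (2 * real k)"
      using assms by (simp add: \<alpha>_def field_simps)
    also have "(\<lambda>n. real n powr (\<beta> - 3 * \<beta> / (2 * real k)) * sqrt (l n)) \<in>
        O(\<lambda>n. real n powr (\<beta> - 3 * \<beta> / (2 * real k)) * sqrt (ln (real n)))"
      by (intro landau_o.big.mult_left to_ln)
    finally show ?thesis .
  qed
  moreover have "E \<in> O(\<lambda>n. real n powr (\<beta> - 3 / 4) * ln (real n))" if "real k = 2 * \<beta>"
  proof -
    have half: "\<alpha> = 1 / 2"
      using that assms by (simp add: \<alpha>_def)
    then have "E \<in> O(\<lambda>n. real n powr (\<beta> - 2 * \<alpha> + 1 / 4) * l n)"
      using V_bound_half \<alpha> l_ge_1 by (intro bigo l_mono) (auto simp: l_def)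
    also have "\<beta> - 2 * \<alpha> + 1 / 4 = \<beta> - 3 / 4"
      using half by simp
    also have "(\<lambda>n. real n powr (\<beta> - 3 / 4) * l n) \<in> O(\<lambda>n. real n powr (\<beta> - 3 / 4) * ln (real n))"
      by (intro landau_o.big.mult_left to_ln)
    finally show ?thesis .
  qed
  moreover have "incseq A"
    using slice_mono[OF a a] by (intro incseq_SucI) (simp add: A_def)
  moreover have "A i > 0" for i
    using slice_pos[OF a] by (simp add: A_def)
  moreover have "filterlim A at_top sequentially"
    unfolding filterlim_at_top
  proof
    fix z
    obtain N where N: "\<And>i. a i \<le> nat z \<Longrightarrow> i < N"
      using finite_fibre[OF a, of "nat z"] by (auto simp: finite_nat_set_iff_bounded)
    have "z \<le> A i" if "i \<ge> N" for i
    proof -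
      have "nat z < a i"
        using N[of i] that by (meson leD not_le)
      then show ?thesis
        unfolding A_def by arith
    qed
    then show "eventually (\<lambda>i. z \<le> A i) sequentially"
      by (auto simp: eventually_sequentially)
  qed
  ultimately show ?thesis
    using C unfolding Let_def E_def[abs_def] by (intro exI[of _ A] exI[of _ C]) blast
qed

end
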